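(* Let $\mathfrak{l}=(\mathbb{R}Z\oplus\mathfrak{su}(2))\ltimes\mathfrak{n}$ be a real finite-dimensional Lie algebra, where $\mathfrak{n}$ is a nilpotent ideal, $\mathbb{R}Z\oplus\mathfrak{su}(2)$ is a subalgebra, and $[Z,\mathfrak{su}(2)]=0$. Let $\mathfrak{n}=\mathfrak{n}_1\oplus\dots\oplus\mathfrak{n}_k$ be a decomposition of $\mathfrak{n}$ into irreducible components for the adjoint action of $\mathfrak{su}(2)$ on $\mathfrak{n}$. If $[\mathfrak{su}(2),\mathfrak{n}]\neq 0$ and $\operatorname{ad}Z$ acts on each $\mathfrak{n}_i$ as a positive multiple of the identity (the multiple may depend on $i$), then $\mathfrak{l}$ admits an inner product with negative Ricci curvature.
   Context: Ricci curvature: an inner product $\langle\cdot,\cdot\rangle$ on a real finite-dimensional Lie algebra $\mathfrak{g}$ has negative Ricci curvature if the Ricci operator of the corresponding left-invariant Riemannian metric on a Lie group with Lie algebra $\mathfrak{g}$ is negative definite. Explicitly, the Ricci operator is $\operatorname{Ric}=M-\tfrac12 B-S(\operatorname{ad}H)$, where $H\in\mathfrak{g}$ is defined by $\langle H,X\rangle=\operatorname{tr}\operatorname{ad}X$ for all $X$, $S(A)=\tfrac12(A+A^t)$, $B$ is the symmetric operator with $\langle BX,X\rangle=\operatorname{tr}(\operatorname{ad}X)^2$, and $M$ is the symmetric operator with $\langle MX,X\rangle=-\tfrac12\sum_{i,j}\langle[X,X_i],X_j\rangle^2+\tfrac14\sum_{i,j}\langle[X_i,X_j],X\rangle^2$ for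 any orthonormal basis $\{X_i\}$ of $\mathfrak{g}$. *)

theory Defs
  imports "HOL-Analysis.Analysis"
begin

text \<open>
  Finite-dimensional real vector spaces are rendered by the class
  \<^class>\<open>euclidean_space\<close>; its built-in inner product plays no role beyond
  supplying coordinates. The Lie bracket and the inner products whose curvature is
  considered are explicit parameters \<open>br\<close> and \<open>ip\<close>.
\<close>

section \<open>Lie algebras\<close>

definition lie_algebra :: "('a::real_vector \<Rightarrow> 'a \<Rightarrow> 'a) \<Rightarrow> bool" where
  "lie_algebra br \<longleftrightarrow>
     bilinear br \<and>
     (\<forall>x. br x x = 0) \<and>
     (\<forall>x y z. br x (br y z) + br y (br z x) + br z (br x y) = 0)"

definition lie_subalgebra :: "('a::real_vector \<Rightarrow> 'a \<Rightarrow> 'a) \<Rightarrow> 'a set \<Rightarrow> bool" where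
  "lie_subalgebra br K \<longleftrightarrow> subspace K \<and> (\<forall>x\<in>K. \<forall>y\<in>K. br x y \<in> K)"

definition lie_ideal :: "('a::real_vector \<Rightarrow> 'a \<Rightarrow> 'a) \<Rightarrow> 'a set \<Rightarrow> bool" where
  "lie_ideal br N \<longleftrightarrow> subspace N \<and> (\<forall>x. \<forall>y\<in>N. br x y \<in> N)"

primrec lower_central_series ::
    "('a::real_vector \<Rightarrow> 'a \<Rightarrow> 'a) \<Rightarrow> 'a set \<Rightarrow> nat \<Rightarrow> 'a set" where
  "lower_central_series br N 0 = N"
| "lower_central_series br N (Suc m) =
     span {br x y | x y. x \<in> N \<and> y \<in> lower_central_series br N m}"

definition lie_nilpotent :: "('a::real_vector \<Rightarrow> 'a \<Rightarrow> 'a) \<Rightarrow> 'a set \<Rightarrow> bool" where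
  "lie_nilpotent br N \<longleftrightarrow> (\<exists>m. lower_central_series br N m = {0})"

text \<open>Traceless skew-Hermitian complex 2 by 2 matrices, a real subspace of
  \<^typ>\<open>complex^2^2\<close>.\<close>

definition su2 :: "(complex^2^2) set" where
  "su2 = {A. (\<chi> i j. cnj (A $ j $ i)) = - A \<and> trace A = 0}"

definition isomorphic_su2 :: "('a::real_vector \<Rightarrow> 'a \<Rightarrow> 'a) \<Rightarrow> 'a set \<Rightarrow> bool" where
  "isomorphic_su2 br S \<longleftrightarrow>
     (\<exists>\<phi> :: complex^2^2 \<Rightarrow> 'a.
        bij_betw \<phi> su2 S \<and>
        (\<forall>A\<in>su2. \<forall>B\<in>su2. \<phi> (A + B) = \<phi> A + \<phi> B) \<and>
        (\<forall>c::real. \<forall>A\<in>su2. \<phi> (c *\<^sub>R A) = c *\<^sub>R \<phi> A) \<and>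
        (\<forall>A\<in>su2. \<forall>B\<in>su2. \<phi> (A ** B - B ** A) = br (\<phi> A) (\<phi> B)))"

section \<open>Direct sums and irreducible components\<close>

text \<open>In the next definition \<open>U + V\<close> is the elementwise sum of sets.\<close>

definition direct_sum2 :: "'a::real_vector set \<Rightarrow> 'a set \<Rightarrow> 'a set \<Rightarrow> bool" where
  "direct_sum2 W U V \<longleftrightarrow> subspace U \<and> subspace V \<and> U \<inter> V = {0} \<and> W = U + V"

definition direct_sum_family :: "'a::real_vector set \<Rightarrow> 'i set \<Rightarrow> ('i \<Rightarrow> 'a set) \<Rightarrow> bool" where
  "direct_sum_family W I V \<longleftrightarrow>
     finite I \<and>
     (\<forall>i\<in>I. subspace (V i) \<and> V i \<subseteq> W) \<and>
     (\<forall>x\<in>W. \<exists>!f. f \<in> (\<Pi>\<^sub>E i\<in>I. V i) \<and> x = (\<Sum>i\<in>I. f i))"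

definition invariant_subspace ::
    "('a::real_vector \<Rightarrow> 'a \<Rightarrow> 'a) \<Rightarrow> 'a set \<Rightarrow> 'a set \<Rightarrow> bool" where
  "invariant_subspace br S U \<longleftrightarrow> subspace U \<and> (\<forall>x\<in>S. \<forall>u\<in>U. br x u \<in> U)"

definition irreducible_component ::
    "('a::real_vector \<Rightarrow> 'a \<Rightarrow> 'a) \<Rightarrow> 'a set \<Rightarrow> 'a set \<Rightarrow> bool" where
  "irreducible_component br S V \<longleftrightarrow>
     invariant_subspace br S V \<and> V \<noteq> {0} \<and>
     (\<forall>U. invariant_subspace br S U \<and> U \<subseteq> V \<longrightarrow> U = {0} \<or> U = V)"

section \<open>Inner products and the Ricci operator\<close>

definition inner_product :: "('a::real_vector \<Rightarrow> 'a \<Rightarrow> real) \<Rightarrow> bool" where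
  "inner_product ip \<longleftrightarrow>
     bilinear ip \<and> (\<forall>x y. ip x y = ip y x) \<and> (\<forall>x. x \<noteq> 0 \<longrightarrow> ip x x > 0)"

definition orthonormal_basis :: "('a::real_vector \<Rightarrow> 'a \<Rightarrow> real) \<Rightarrow> 'a set \<Rightarrow> bool" where
  "orthonormal_basis ip E \<longleftrightarrow>
     (\<forall>x\<in>E. \<forall>y\<in>E. ip x y = (if x = y then 1 else 0)) \<and> span E = UNIV"

text \<open>The trace of a linear operator does not depend on the basis; the standard one is
  used to compute it.\<close>

definition op_trace :: "('a::euclidean_space \<Rightarrow> 'a) \<Rightarrow> real" where
  "op_trace f = (\<Sum>b\<in>Basis. f b \<bullet> b)"

definition symmetric_op :: "('a::real_vector \<Rightarrow> 'a \<Rightarrow> real) \<Rightarrow> ('a \<Rightarrow> 'a) \<Rightarrow> bool" where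
  "symmetric_op ip T \<longleftrightarrow> linear T \<and> (\<forall>x y. ip (T x) y = ip x (T y))"

text \<open>For \<open>br\<close> a Lie bracket and \<open>ip\<close> an inner product, each of the
  following definite descriptions has exactly one solution (for the transpose: when
  \<open>A\<close> is linear).\<close>

definition transpose_op ::
    "('a::real_vector \<Rightarrow> 'a \<Rightarrow> real) \<Rightarrow> ('a \<Rightarrow> 'a) \<Rightarrow> 'a \<Rightarrow> 'a" where
  "transpose_op ip A = (THE A'. \<forall>x y. ip (A x) y = ip x (A' y))"

definition sym_part ::
    "('a::real_vector \<Rightarrow> 'a \<Rightarrow> real) \<Rightarrow> ('a \<Rightarrow> 'a) \<Rightarrow> 'a \<Rightarrow> 'a" where
  "sym_part ip A = (\<lambda>x. (1/2) *\<^sub>R (A x + transpose_op ip A x))"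

definition mean_curvature_vector ::
    "('a::euclidean_space \<Rightarrow> 'a \<Rightarrow> 'a) \<Rightarrow> ('a \<Rightarrow> 'a \<Rightarrow> real) \<Rightarrow> 'a" where
  "mean_curvature_vector br ip = (THE H. \<forall>X. ip H X = op_trace (br X))"

definition killing_op ::
    "('a::euclidean_space \<Rightarrow> 'a \<Rightarrow> 'a) \<Rightarrow> ('a \<Rightarrow> 'a \<Rightarrow> real) \<Rightarrow> 'a \<Rightarrow> 'a" where
  "killing_op br ip =
     (THE B. symmetric_op ip B \<and> (\<forall>X. ip (B X) X = op_trace (br X \<circ> br X)))"

definition M_op ::
    "('a::real_vector \<Rightarrow> 'a \<Rightarrow> 'a) \<Rightarrow> ('a \<Rightarrow> 'a \<Rightarrow> real) \<Rightarrow> 'a \<Rightarrow> 'a" where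
  "M_op br ip =
     (THE M. symmetric_op ip M \<and>
        (\<forall>E. orthonormal_basis ip E \<longrightarrow>
           (\<forall>X. ip (M X) X =
              - (1/2) * (\<Sum>u\<in>E. \<Sum>v\<in>E. (ip (br X u) v)\<^sup>2)
              + (1/4) * (\<Sum>u\<in>E. \<Sum>v\<in>E. (ip (br u v) X)\<^sup>2))))"

definition ricci_op ::
    "('a::euclidean_space \<Rightarrow> 'a \<Rightarrow> 'a) \<Rightarrow> ('a \<Rightarrow> 'a \<Rightarrow> real) \<Rightarrow> 'a \<Rightarrow> 'a" where
  "ricci_op br ip = (\<lambda>X.
     M_op br ip X - (1/2) *\<^sub>R killing_op br ip X
       - sym_part ip (br (mean_curvature_vector br ip)) X)"

definition negative_ricci ::
    "('a::euclidean_space \<Rightarrow> 'a \<Rightarrow> 'a) \<Rightarrow> ('a \<Rightarrow> 'a \<Rightarrow> real) \<Rightarrow> bool" where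
  "negative_ricci br ip \<longleftrightarrow> (\<forall>X. X \<noteq> 0 \<longrightarrow> ip (ricci_op br ip X) X < 0)"

end

theory Submission
  imports Defs
begin

text \<open>
  In terms of an orthonormal basis \<open>E\<close> the Ricci form is a difference of two sums of
  squares and a mean curvature term,
  \<open>Ric(X, X) = 1/4 (\<Sum>u v. \<langle>[u, v], X\<rangle>\<^sup>2) - 1/4 (\<Sum>u v. (\<langle>[X, u], v\<rangle> + \<langle>[X, v], u\<rangle>)\<^sup>2) - \<langle>[H, X], X\<rangle>\<close>
  (lemma \<open>ricci_quadratic\<close>). The middle sum measures how far \<open>ad X\<close> is from being
  skew, and any part of it may be thrown away in an upper bound.

  Only inner products making \<open>Z\<close>, \<open>su(2)\<close> and \<open>n\<close> orthogonal are needed, with an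
  orthonormal basis of the form \<open>Z\<close>, \<open>\<sigma> X\<^sub>1\<close>, \<open>\<sigma> X\<^sub>2\<close>, \<open>\<sigma> X\<^sub>3\<close>,
  \<open>(\<sigma> / \<rho> u) u\<close>. Here \<open>X\<^sub>1, X\<^sub>2, X\<^sub>3\<close> is the basis of \<open>su(2)\<close> with the cross product
  brackets and \<open>u\<close> runs over a basis \<open>F\<close> of \<open>n\<close> consisting of eigenvectors of \<open>ad Z\<close>.
  Taking traces of commutators shows that \<open>H\<close> is \<open>h Z\<close> with \<open>h = tr ad Z > 0\<close>. Hence:

  \<^item> On \<open>n\<close> the mean curvature term is negative definite and of fixed size. It controls
  the contribution of \<open>[Z, n]\<close> to the first sum, because every eigenvalue is at most
  \<open>h\<close>. The remaining terms without a favourable sign come from \<open>[su(2), n]\<close> and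
  \<open>[n, n]\<close>. The structure constants of both carry a factor \<open>\<sigma>\<close>, so these terms are
  negligible for small \<open>\<sigma>\<close>.

  \<^item> On \<open>Z\<close> the middle sum is positive, and so the Ricci form negative, since \<open>ad Z\<close> is
  symmetric and nonzero on \<open>n\<close>. The mixed term of \<open>Z\<close> and \<open>x\<close> in \<open>su(2)\<close> is a
  multiple of \<open>tr (ad Z ad x)\<close>, which vanishes because \<open>x\<close> is a bracket of elements commuting with \<open>Z\<close>.

  \<^item> On \<open>su(2)\<close> the first sum contributes a positive term, and the middle sum has to
  outweigh it: the action of \<open>su(2)\<close> on \<open>n\<close> has to be made far from skew. With
  \<open>\<rho> u = \<tau> ^ idx u\<close> for an enumeration \<open>idx\<close> of \<open>F\<close>, the entries of \<open>ad x\<close> on one side of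
  the diagonal get multiplied by positive powers of \<open>\<tau>\<close>. So the middle sum tends to
  infinity with \<open>\<tau>\<close>, uniformly in unit vectors \<open>x\<close>, unless some \<open>x \<noteq> 0\<close> acts by a triangular
  matrix. This is impossible (lemma \<open>triangular_su2_trivial\<close>): for \<open>y = [x, w]\<close> the
  identity \<open>[x, [x, y]] = - c y\<close> with \<open>c > 0\<close> would make a negative number an eigenvalue
  of \<open>(ad T)\<^sup>2\<close> for a real triangular matrix \<open>T\<close> as soon as \<open>y\<close> acts nontrivially, whereas
  the eigenvalues of \<open>ad T\<close> are differences of diagonal entries of \<open>T\<close>, hence real.

  The parameters are chosen in this order: first \<open>\<tau>\<close> large, then \<open>\<sigma>\<close> small. The
  condition on \<open>\<tau>\<close> does not involve \<open>\<sigma>\<close>, because \<open>Ric(x, x)\<close> for a fixed \<open>x\<close> in \<open>su(2)\<close>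
  is unchanged when the inner product on \<open>su(2)\<close> or on \<open>n\<close> is multiplied by a constant.
\<close>

section \<open>Traces and orthonormal bases\<close>

lemma op_trace_commute:
  fixes f g :: "'a::euclidean_space \<Rightarrow> 'a"
  assumes "linear f" "linear g"
  shows "op_trace (f \<circ> g) = op_trace (g \<circ> f)"
proof -
  have *: "op_trace (f \<circ> g) = (\<Sum>b\<in>Basis. \<Sum>c\<in>Basis. (g b \<bullet> c) * (f c \<bullet> b))"
    if "linear f" for f g :: "'a \<Rightarrow> 'a"
  proof -
    have "f (g b) \<bullet> b = (\<Sum>c\<in>Basis. (g b \<bullet> c) * (f c \<bullet> b))" for b
      by (subst euclidean_representation[of "g b", symmetric])
         (simp add: linear_sum[OF that] linear_scale[OF that] inner_sum_left)
    then show ?thesis by (simp add: op_trace_def)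
  qed
  show ?thesis
    unfolding *[OF assms(1)] *[OF assms(2)] by (subst sum.swap) (simp add: mult.commute)
qed

locale orthonormal_frame =
  fixes ip :: "'a::euclidean_space \<Rightarrow> 'a \<Rightarrow> real" and E :: "'a set"
  assumes inner_product: "inner_product ip" and orthonormal: "orthonormal_basis ip E"
begin

lemma bilinear_ip: "bilinear ip"
  using inner_product by (simp add: inner_product_def)

lemma ip_commute: "ip x y = ip y x"
  using inner_product by (simp add: inner_product_def)

lemma ip_pos: "x \<noteq> 0 \<Longrightarrow> ip x x > 0"
  using inner_product by (simp add: inner_product_def)

lemmas ip_simps [simp] =
  bilinear_ladd[OF bilinear_ip] bilinear_radd[OF bilinear_ip]
  bilinear_lmul[OF bilinear_ip] bilinear_rmul[OF bilinear_ip]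
  bilinear_lneg[OF bilinear_ip] bilinear_rneg[OF bilinear_ip]
  bilinear_lzero[OF bilinear_ip] bilinear_rzero[OF bilinear_ip]
  bilinear_lsub[OF bilinear_ip] bilinear_rsub[OF bilinear_ip]

lemma linear_ip_left: "linear (\<lambda>x. ip x y)"
  and linear_ip_right: "linear (\<lambda>y. ip x y)"
  using bilinear_ip by (auto simp: bilinear_def)

lemma ip_sum_left: "ip (\<Sum>i\<in>I. f i) y = (\<Sum>i\<in>I. ip (f i) y)"
  using linear_sum[OF linear_ip_left] by simp

lemma ip_sum_right: "ip x (\<Sum>i\<in>I. f i) = (\<Sum>i\<in>I. ip x (f i))"
  using linear_sum[OF linear_ip_right] by simp

lemma ip_eqI: "(\<And>y. ip x y = ip x' y) \<Longrightarrow> x = x'"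
  using ip_pos[of "x - x'"] by force

lemma ip_frame: "u \<in> E \<Longrightarrow> v \<in> E \<Longrightarrow> ip u v = (if u = v then 1 else 0)"
  using orthonormal by (simp add: orthonormal_basis_def)

lemma span_frame: "span E = UNIV"
  using orthonormal by (simp add: orthonormal_basis_def)

lemma independent_frame: "independent E"
proof -
  have "f v = 0" if "finite T" "T \<subseteq> E" "(\<Sum>v\<in>T. f v *\<^sub>R v) = 0" "v \<in> T" for f T v
  proof -
    have "0 = ip (\<Sum>v\<in>T. f v *\<^sub>R v) v" using that by simp
    also have "\<dots> = (\<Sum>u\<in>T. f u * (if u = v then 1 else 0))"
      unfolding ip_sum_left using that by (intro sum.cong) (auto simp: ip_frame subset_eq)
    also have "\<dots> = (\<Sum>u\<in>T. if u = v then f u else 0)" by (intro sum.cong) auto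
    also have "\<dots> = f v" using that by simp
    finally show ?thesis by simp
  qed
  then show ?thesis
    unfolding dependent_explicit by metis
qed

lemma finite_frame: "finite E"
  using independent_frame by (rule finiteI_independent)

text \<open>The versions with a subset \<open>T\<close> of the basis serve to expand elements of
  \<open>su(2)\<close> and of \<open>n\<close> in their own part of an adapted basis.\<close>
lemma frame_expansion_within:
  assumes "T \<subseteq> E" "x \<in> span T"
  shows "x = (\<Sum>e\<in>T. ip x e *\<^sub>R e)"
  using assms(2)
proof (induction rule: span_induct_alt)
  case base
  show ?case by simp
next
  case (step c u y)
  have fin: "finite T" using finite_frame assms finite_subset by blast
  have "(\<Sum>e\<in>T. ip u e *\<^sub>R e) = (\<Sum>e\<in>T. if e = u then e else 0)"
    using step(1) assms(1) by (intro sum.cong) (auto simp: ip_frame subset_eq)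
  also have "\<dots> = u" using step(1) fin by simp
  finally have u: "(\<Sum>e\<in>T. ip u e *\<^sub>R e) = u" .
  show ?case
    using u step(2)
    by (simp add: scaleR_add_left sum.distrib flip: scaleR_sum_right scaleR_scaleR)
qed

lemma frame_expansion: "(\<Sum>e\<in>E. ip x e *\<^sub>R e) = x"
  using frame_expansion_within[of E x] span_frame by simp

lemma linear_expansion:
  assumes "linear f" shows "f x = (\<Sum>e\<in>E. ip x e *\<^sub>R f e)"
  using linear_sum[OF assms, of "\<lambda>e. ip x e *\<^sub>R e" E] frame_expansion[of x]
  by (simp add: linear_scale[OF assms])

lemma linear_expansion_within:
  assumes "linear f" "T \<subseteq> E" "x \<in> span T"
  shows "f x = (\<Sum>e\<in>T. ip x e *\<^sub>R f e)"
  using linear_sum[OF assms(1), of "\<lambda>e. ip x e *\<^sub>R e" T] frame_expansion_within[OF assms(2,3)]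
  by (simp add: linear_scale[OF assms(1)])

lemma parseval: "ip x y = (\<Sum>e\<in>E. ip x e * ip y e)"
  using linear_expansion[OF linear_ip_left, of x y] by (simp add: ip_commute)

lemma parseval_within:
  assumes "T \<subseteq> E" "x \<in> span T"
  shows "ip x y = (\<Sum>e\<in>T. ip x e * ip y e)"
  using linear_expansion_within[OF linear_ip_left assms, of y] by (simp add: ip_commute)

lemma ip_orthogonal_span:
  assumes "T \<subseteq> E" "x \<in> span T" "u \<in> E" "u \<notin> T"
  shows "ip x u = 0"
  using assms(2)
proof (induction rule: span_induct_alt)
  case (step c v y)
  then have "ip v u = 0" using assms by (auto simp: ip_frame)
  with step show ?case by simp
qed simp

lemma op_trace_frame:
  assumes "linear f" shows "op_trace f = (\<Sum>e\<in>E. ip (f e) e)"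
proof -
  have "op_trace f = (\<Sum>b\<in>Basis. \<Sum>e\<in>E. ip b e * (f e \<bullet> b))"
    unfolding op_trace_def
    by (intro sum.cong refl, subst linear_expansion[OF assms]) (simp add: inner_sum_left)
  also have "\<dots> = (\<Sum>e\<in>E. ip (\<Sum>b\<in>Basis. (f e \<bullet> b) *\<^sub>R b) e)"
    by (subst sum.swap) (simp add: ip_sum_left mult.commute)
  finally show ?thesis by (simp add: euclidean_representation)
qed

lemma ex_riesz:
  assumes "linear f" shows "\<exists>a. \<forall>x. f x = ip a x"
proof (intro exI allI)
  show "f x = ip (\<Sum>e\<in>E. f e *\<^sub>R e) x" for x
    using linear_expansion[OF assms, of x] by (simp add: ip_sum_left ip_commute[of x] mult.commute)
qed

text \<open>By Riesz both sides are the squared length of the vector representing \<open>f\<close>. Applied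
  to each argument in turn, this shows that the operator \<open>M\<close> is well defined, that is,
  given by the same formula in every orthonormal basis.\<close>
lemma sum_squares_frame_independent:
  assumes "orthonormal_basis ip E'" "linear f"
  shows "(\<Sum>u\<in>E'. (f u)\<^sup>2) = (\<Sum>u\<in>E. (f u :: real)\<^sup>2)"
proof -
  interpret E': orthonormal_frame ip E'
    using inner_product assms(1) by unfold_locales
  obtain a where a: "\<And>x. f x = ip a x" using ex_riesz[OF assms(2)] by blast
  show ?thesis
    using parseval[of a a] E'.parseval[of a a] by (simp add: a power2_eq_square)
qed

lemma sum_squares_form_frame_independent:
  assumes "orthonormal_basis ip E'" "bilinear b"
  shows "(\<Sum>u\<in>E'. \<Sum>v\<in>E'. (b u v)\<^sup>2) = (\<Sum>u\<in>E. \<Sum>v\<in>E. (b u v :: real)\<^sup>2)"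
proof -
  have lin: "linear (\<lambda>v. b u v)" "linear (\<lambda>u. b u v)" for u v
    using assms(2) by (auto simp: bilinear_def)
  have "(\<Sum>u\<in>E'. \<Sum>v\<in>E'. (b u v)\<^sup>2) = (\<Sum>u\<in>E'. \<Sum>v\<in>E. (b u v)\<^sup>2)"
    using sum_squares_frame_independent[OF assms(1) lin(1)] by simp
  also have "\<dots> = (\<Sum>v\<in>E. \<Sum>u\<in>E'. (b u v)\<^sup>2)" by (rule sum.swap)
  also have "\<dots> = (\<Sum>v\<in>E. \<Sum>u\<in>E. (b u v)\<^sup>2)"
    using sum_squares_frame_independent[OF assms(1) lin(2)] by simp
  also have "\<dots> = (\<Sum>u\<in>E. \<Sum>v\<in>E. (b u v)\<^sup>2)" by (rule sum.swap)
  finally show ?thesis .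
qed

text \<open>This evaluates the definite descriptions of the operators \<open>B\<close> and \<open>M\<close>; uniqueness is
  polarization.\<close>
lemma ex1_symmetric_op:
  assumes "bilinear \<beta>" "\<And>x y. \<beta> x y = \<beta> y x"
  shows "\<exists>!T. symmetric_op ip T \<and> (\<forall>x. ip (T x) x = \<beta> x x)"
proof (rule ex_ex1I)
  have lin: "linear (\<lambda>y. \<beta> x y)" "linear (\<lambda>x. \<beta> x y)" for x y
    using assms(1) by (auto simp: bilinear_def)
  define T where "T x = (\<Sum>e\<in>E. \<beta> x e *\<^sub>R e)" for x
  have T: "ip (T x) y = \<beta> x y" for x y
    using linear_expansion[OF lin(1), of x y]
    by (simp add: T_def ip_sum_left ip_commute[of y] mult.commute)
  have "linear T"
    by (rule linearI; rule ip_eqI)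
       (simp_all add: T bilinear_ladd[OF assms(1)] bilinear_lmul[OF assms(1)])
  moreover have "ip (T x) y = ip x (T y)" for x y
    using T assms(2) ip_commute by metis
  ultimately show "\<exists>T. symmetric_op ip T \<and> (\<forall>x. ip (T x) x = \<beta> x x)"
    using T by (auto simp: symmetric_op_def)
next
  fix T T'
  assume T: "symmetric_op ip T \<and> (\<forall>x. ip (T x) x = \<beta> x x)"
    and T': "symmetric_op ip T' \<and> (\<forall>x. ip (T' x) x = \<beta> x x)"
  have polar: "2 * ip (R x) y = ip (R (x + y)) (x + y) - ip (R x) x - ip (R y) y"
    if "symmetric_op ip R" for R x y
    using that ip_commute[of "R y" x] by (simp add: symmetric_op_def linear_add)
  show "T = T'"
  proof (rule ext, rule ip_eqI)
    fix x y
    show "ip (T x) y = ip (T' x) y"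
      using polar[of T x y] polar[of T' x y] T T' by (simp del: ip_simps)
  qed
qed

lemma ip_transpose_op:
  assumes "linear A"
  shows "ip (transpose_op ip A x) y = ip x (A y)"
proof -
  define A' where "A' y = (\<Sum>e\<in>E. ip (A e) y *\<^sub>R e)" for y
  have A': "ip (A x) y = ip x (A' y)" for x y
  proof -
    have "ip (A x) y = (\<Sum>e\<in>E. ip x e * ip (A e) y)"
      by (subst linear_expansion[OF assms, of x]) (simp add: ip_sum_left)
    then show ?thesis by (simp add: A'_def ip_sum_right mult.commute)
  qed
  have "transpose_op ip A = A'"
    unfolding transpose_op_def
  proof (rule the_equality)
    fix B assume B: "\<forall>x y. ip (A x) y = ip x (B y)"
    show "B = A'"
      by (rule ext, rule ip_eqI) (metis A' B ip_commute)
  qed (use A' in blast)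
  then show ?thesis using A' ip_commute by metis
qed

lemma ip_sym_part:
  assumes "linear A"
  shows "ip (sym_part ip A x) x = ip (A x) x"
  by (simp add: sym_part_def ip_transpose_op[OF assms] ip_commute[of x])

end

section \<open>The Ricci form in an orthonormal basis\<close>
lemma bilinear_sum_of_products:
  assumes "\<And>i. i \<in> I \<Longrightarrow> linear (f i)"
  shows "bilinear (\<lambda>x y. \<Sum>i\<in>I. f i x * f i y :: real)"
  unfolding bilinear_def linear_iff
  using assms
  by (auto simp: linear_add linear_scale algebra_simps sum_distrib_left sum.distrib)

lemma bilinear_lin_comb:
  assumes "bilinear f" "bilinear g"
  shows "bilinear (\<lambda>x y. a * f x y + b * g x y :: real)"
  unfolding bilinear_def linear_iff
  by (auto simp: bilinear_ladd[OF assms(1)] bilinear_ladd[OF assms(2)] bilinear_radd[OF assms(1)]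
      bilinear_radd[OF assms(2)] bilinear_lmul[OF assms(1)] bilinear_lmul[OF assms(2)]
      bilinear_rmul[OF assms(1)] bilinear_rmul[OF assms(2)] algebra_simps)

locale lie_frame = orthonormal_frame ip E
  for ip :: "'a::euclidean_space \<Rightarrow> 'a \<Rightarrow> real" and E +
  fixes br :: "'a \<Rightarrow> 'a \<Rightarrow> 'a"
  assumes lie_algebra: "lie_algebra br"
begin

lemma bilinear_br: "bilinear br"
  using lie_algebra by (simp add: lie_algebra_def)

lemmas br_simps [simp] =
  bilinear_ladd[OF bilinear_br] bilinear_radd[OF bilinear_br]
  bilinear_lmul[OF bilinear_br] bilinear_rmul[OF bilinear_br]
  bilinear_lneg[OF bilinear_br] bilinear_rneg[OF bilinear_br]
  bilinear_lzero[OF bilinear_br] bilinear_rzero[OF bilinear_br]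
  bilinear_lsub[OF bilinear_br] bilinear_rsub[OF bilinear_br]

lemma linear_br: "linear (br x)" and linear_br_left: "linear (\<lambda>x. br x y)"
  using bilinear_br by (auto simp: bilinear_def)

lemma br_self [simp]: "br x x = 0"
  using lie_algebra by (simp add: lie_algebra_def)

lemma br_anticommute: "br x y = - br y x"
proof -
  have "br (x + y) (x + y) = br x y + br y x"
    by (simp add: add.commute del: br_self) simp
  then show ?thesis by (simp add: eq_neg_iff_add_eq_0)
qed

lemma jacobi: "br (br x y) z = br x (br y z) - br y (br x z)"
proof -
  have "br x (br y z) + br y (br z x) + br z (br x y) = 0"
    using lie_algebra by (simp add: lie_algebra_def)
  then show ?thesis
    using br_anticommute[of z x] br_anticommute[of z "br x y"] by (simp add: algebra_simps)
qed

lemma linear_op_trace_br: "linear (\<lambda>X. op_trace (br X))"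
  by (rule linearI) (simp_all add: op_trace_def sum.distrib sum_distrib_left inner_add_left)

lemma mean_curvature_vector_frame:
  "mean_curvature_vector br ip = (\<Sum>u\<in>E. op_trace (br u) *\<^sub>R u)"
  unfolding mean_curvature_vector_def
proof (rule the_equality)
  show *: "\<forall>X. ip (\<Sum>u\<in>E. op_trace (br u) *\<^sub>R u) X = op_trace (br X)"
  proof
    fix X show "ip (\<Sum>u\<in>E. op_trace (br u) *\<^sub>R u) X = op_trace (br X)"
      using linear_expansion[OF linear_op_trace_br, of X]
      by (simp add: ip_sum_left ip_commute[of X] mult.commute)
  qed
  show "H = (\<Sum>u\<in>E. op_trace (br u) *\<^sub>R u)" if "\<forall>X. ip H X = op_trace (br X)" for H
    using that * by (intro ip_eqI) simp
qed

lemma killing_op_quadratic: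
  "ip (killing_op br ip X) X = op_trace (br X \<circ> br X)"
proof -
  have "\<exists>!T. symmetric_op ip T \<and> (\<forall>x. ip (T x) x = op_trace (br x \<circ> br x))"
  proof (rule ex1_symmetric_op[where \<beta> = "\<lambda>x y. op_trace (br x \<circ> br y)"])
    show "bilinear (\<lambda>x y. op_trace (br x \<circ> br y))"
      unfolding bilinear_def linear_iff
      by (auto simp: op_trace_def sum.distrib sum_distrib_left inner_add_left)
    show "op_trace (br x \<circ> br y) = op_trace (br y \<circ> br x)" for x y
      by (rule op_trace_commute) (rule linear_br)+
  qed
  from theI'[OF this] show ?thesis by (simp add: killing_op_def)
qed

lemma M_op_quadratic:
  "ip (M_op br ip X) X =
     - (1/2) * (\<Sum>u\<in>E. \<Sum>v\<in>E. (ip (br X u) v)\<^sup>2) + (1/4) * (\<Sum>u\<in>E. \<Sum>v\<in>E. (ip (br u v) X)\<^sup>2)"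
proof -
  define q where "q E' X =
     - (1/2) * (\<Sum>u\<in>E'. \<Sum>v\<in>E'. (ip (br X u) v)\<^sup>2) + (1/4) * (\<Sum>u\<in>E'. \<Sum>v\<in>E'. (ip (br u v) X)\<^sup>2)"
    for E' X
  have q: "q E' X = q E X" if "orthonormal_basis ip E'" for E' X
  proof -
    have "bilinear (\<lambda>u v. ip (br X u) v)" "bilinear (\<lambda>u v. ip (br u v) X)"
      by (auto simp: bilinear_def linear_iff)
    then show ?thesis
      unfolding q_def using sum_squares_form_frame_independent[OF that] by simp
  qed
  define \<beta> where "\<beta> x y =
     - (1/2) * (\<Sum>p\<in>E\<times>E. ip (br x (fst p)) (snd p) * ip (br y (fst p)) (snd p)) +
     (1/4) * (\<Sum>p\<in>E\<times>E. ip (br (fst p) (snd p)) x * ip (br (fst p) (snd p)) y)" for x y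
  have \<beta>_diag: "\<beta> x x = q E x" for x
    by (simp add: \<beta>_def q_def power2_eq_square sum.cartesian_product case_prod_beta)
  have "\<exists>!T. symmetric_op ip T \<and> (\<forall>x. ip (T x) x = \<beta> x x)"
  proof (rule ex1_symmetric_op[where \<beta> = \<beta>])
    show "bilinear \<beta>"
      unfolding \<beta>_def
      by (intro bilinear_lin_comb bilinear_sum_of_products) (simp_all add: linear_iff)
  qed (simp add: \<beta>_def mult.commute)
  then have "\<exists>!T. symmetric_op ip T \<and>
      (\<forall>E'. orthonormal_basis ip E' \<longrightarrow> (\<forall>X. ip (T X) X = q E' X))"
    using q orthonormal \<beta>_diag by (smt (verit, best))
  from theI'[OF this] show ?thesis
    using orthonormal by (simp add: M_op_def q_def)
qed

text \<open>The terms \<open>- 1/2 (\<Sum>u. |[X, u]|\<^sup>2)\<close> of \<open>M\<close> and \<open>- 1/2 tr (ad X)\<^sup>2\<close> of \<open>B\<close> combine to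
  minus the squared norm of the symmetric part of \<open>ad X\<close>, which makes the sign of their
  sum visible.\<close>
lemma ricci_quadratic:
  "ip (ricci_op br ip X) X =
     (1/4) * (\<Sum>u\<in>E. \<Sum>v\<in>E. (ip (br u v) X)\<^sup>2)
     - (1/4) * (\<Sum>u\<in>E. \<Sum>v\<in>E. (ip (br X u) v + ip (br X v) u)\<^sup>2)
     - ip (br (\<Sum>u\<in>E. op_trace (br u) *\<^sub>R u) X) X"
proof -
  have "op_trace (br X \<circ> br X) = (\<Sum>u\<in>E. ip (br X (br X u)) u)"
    using op_trace_frame[OF linear_compose[OF linear_br linear_br]] by simp
  also have "\<dots> = (\<Sum>u\<in>E. \<Sum>v\<in>E. ip (br X u) v * ip (br X v) u)"
  proof (rule sum.cong)
    show "ip (br X (br X u)) u = (\<Sum>v\<in>E. ip (br X u) v * ip (br X v) u)" for u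
      by (subst linear_expansion[OF linear_br]) (simp add: ip_sum_left)
  qed simp
  finally have killing: "op_trace (br X \<circ> br X) = (\<Sum>u\<in>E. \<Sum>v\<in>E. ip (br X u) v * ip (br X v) u)" .
  have "(\<Sum>u\<in>E. \<Sum>v\<in>E. (ip (br X u) v + ip (br X v) u)\<^sup>2) =
      (\<Sum>u\<in>E. \<Sum>v\<in>E. (ip (br X u) v)\<^sup>2) + (\<Sum>u\<in>E. \<Sum>v\<in>E. (ip (br X v) u)\<^sup>2)
      + 2 * (\<Sum>u\<in>E. \<Sum>v\<in>E. ip (br X u) v * ip (br X v) u)"
    by (simp add: power2_sum sum.distrib sum_distrib_left mult.assoc)
  moreover have "(\<Sum>u\<in>E. \<Sum>v\<in>E. (ip (br X v) u)\<^sup>2) = (\<Sum>u\<in>E. \<Sum>v\<in>E. (ip (br X u) v)\<^sup>2)"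
    by (rule sum.swap)
  ultimately show ?thesis
    by (simp add: ricci_op_def M_op_quadratic killing_op_quadratic ip_sym_part[OF linear_br]
        mean_curvature_vector_frame killing field_simps)
qed

lemma op_trace_bracket: "op_trace (br (br x y)) = 0"
proof -
  have "op_trace (br (br x y)) = op_trace (br x \<circ> br y) - op_trace (br y \<circ> br x)"
    by (simp add: op_trace_def jacobi inner_diff_left sum_subtractf)
  then show ?thesis using op_trace_commute[OF linear_br linear_br, of x y] by simp
qed

text \<open>If \<open>ad z\<close> commutes with \<open>ad x\<close>, then \<open>ad z ad [x, y]\<close> is the commutator of \<open>ad x\<close> with
  \<open>ad z ad y\<close>.\<close>
lemma op_trace_comp_bracket:
  assumes "\<And>v. br z (br x v) = br x (br z v)"
  shows "op_trace (br z \<circ> br (br x y)) = 0"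
proof -
  have "br z \<circ> br (br x y) = (\<lambda>v. br x ((br z \<circ> br y) v) - (br z \<circ> br y) (br x v))"
    by (auto simp: jacobi assms)
  then have "op_trace (br z \<circ> br (br x y)) =
      op_trace (br x \<circ> (br z \<circ> br y)) - op_trace ((br z \<circ> br y) \<circ> br x)"
    by (simp add: op_trace_def inner_diff_left sum_subtractf)
  then show ?thesis
    using op_trace_commute[OF linear_br linear_compose[OF linear_br linear_br], of x z y] by simp
qed

end

section \<open>A curvature bound in bases adapted to su(2)\<close>

text \<open>The same structure occurs twice: with \<open>s = 1\<close> for the initial inner product, in which a
  basis of the Lie algebra is declared orthonormal, and with small \<open>s\<close> after rescaling
  that basis. Both the eigenvectors of \<open>ad Z\<close> and the brackets of \<open>su(2)\<close>
  survive the rescaling, the latter with \<open>s\<close> as structure constant.\<close>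
locale su2_frame = lie_frame ip E br
  for ip :: "'a::euclidean_space \<Rightarrow> 'a \<Rightarrow> real" and E br +
  fixes Z e1 e2 e3 :: 'a and F :: "'a set" and s :: real
  assumes frame_eq: "E = {Z, e1, e2, e3} \<union> F"
    and frame_distinct: "distinct [Z, e1, e2, e3]" "{Z, e1, e2, e3} \<inter> F = {}"
    and br_Z_su2 [simp]: "br Z e1 = 0" "br Z e2 = 0" "br Z e3 = 0"
    and br_su2 [simp]: "br e1 e2 = s *\<^sub>R e3" "br e2 e3 = s *\<^sub>R e1" "br e3 e1 = s *\<^sub>R e2"
    and Z_eigenvector: "u \<in> F \<Longrightarrow> \<exists>c>0. br Z u = c *\<^sub>R u"
    and br_F: "v \<in> F \<Longrightarrow> br x v \<in> span F"
    and F_nonempty: "F \<noteq> {}"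
    and s_pos: "s > 0"
begin

definition R :: "'a set" where "R = {e1, e2, e3}"

definition rate :: "'a \<Rightarrow> real" where "rate u = ip (br Z u) u"

lemma F_subset: "F \<subseteq> E" and R_subset: "R \<subseteq> E" and Z_in: "Z \<in> E"
  using frame_eq by (auto simp: R_def)

lemma finite_F: "finite F"
  using F_subset finite_frame finite_subset by blast

lemma finite_R: "finite R"
  by (simp add: R_def)

lemma sum_R: "sum g R = g e1 + g e2 + g e3"
  using frame_distinct by (simp add: R_def add.assoc)

lemma sum_frame: "sum g E = g Z + sum g R + sum g F"
proof -
  have "E = {Z} \<union> R \<union> F" by (auto simp: frame_eq R_def)
  moreover have "Z \<notin> R" "R \<inter> F = {}" "Z \<notin> F" using frame_distinct by (auto simp: R_def)
  ultimately show ?thesis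
    using finite_F finite_R by (simp add: sum.union_disjoint Int_Un_distrib2 add.assoc)
qed

lemma br_Z_F: "u \<in> F \<Longrightarrow> br Z u = rate u *\<^sub>R u" and rate_pos: "u \<in> F \<Longrightarrow> rate u > 0"
  using Z_eigenvector[of u] ip_frame[of u u] F_subset by (auto simp: rate_def)

lemma br_Z_R: "a \<in> R \<Longrightarrow> br Z a = 0" "a \<in> R \<Longrightarrow> br a Z = 0"
  using br_anticommute[of _ Z] by (auto simp: R_def)

lemma br_su2_rev [simp]:
  "br e2 e1 = - s *\<^sub>R e3" "br e3 e2 = - s *\<^sub>R e1" "br e1 e3 = - s *\<^sub>R e2"
  using br_anticommute[of e2 e1] br_anticommute[of e3 e2] br_anticommute[of e1 e3] by simp_all

lemma ad_Z_commute: "x \<in> span R \<Longrightarrow> br Z (br x v) = br x (br Z v)"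
proof (induction rule: span_induct_alt)
  case (step c a y)
  have "br Z (br a v) = br a (br Z v)" using jacobi[of Z a v] br_Z_R(1)[OF step(1)] by simp
  with step show ?case by simp
qed simp

lemma R_bracket: "a \<in> R \<Longrightarrow> \<exists>b\<in>R. \<exists>c\<in>R. br b c = s *\<^sub>R a"
  using br_su2 by (auto simp: R_def simp del: br_su2)

lemma op_trace_ad_R: "a \<in> R \<Longrightarrow> op_trace (br a) = 0"
proof -
  assume "a \<in> R"
  then obtain b c where "br b c = s *\<^sub>R a" using R_bracket by blast
  then show ?thesis
    using op_trace_bracket[of b c] linear_scale[OF linear_op_trace_br, of s a] s_pos by simp
qed

text \<open>An eigenvector \<open>u\<close> of \<open>ad Z\<close> with nonzero eigenvalue is a multiple of the bracket
  \<open>[Z, u]\<close>, so its adjoint operator is a commutator.\<close>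
lemma op_trace_ad_F: "u \<in> F \<Longrightarrow> op_trace (br u) = 0"
  using op_trace_bracket[of Z u] linear_scale[OF linear_op_trace_br, of "rate u" u]
    br_Z_F[of u] rate_pos[of u] by simp

lemma op_trace_ad_Z: "op_trace (br Z) = (\<Sum>u\<in>F. rate u)"
  by (simp add: op_trace_frame[OF linear_br] sum_frame br_Z_R rate_def)

lemma mean_curvature: "(\<Sum>u\<in>E. op_trace (br u) *\<^sub>R u) = (\<Sum>u\<in>F. rate u) *\<^sub>R Z"
  by (simp add: sum_frame op_trace_ad_R op_trace_ad_F op_trace_ad_Z)

text \<open>The sum is \<open>tr (ad x ad Z)\<close>. Its vanishing removes the mixed term of \<open>Z\<close> and \<open>x\<close> from the
  Ricci form.\<close>
lemma rate_weighted_trace: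
  assumes "x \<in> span R"
  shows "(\<Sum>u\<in>F. rate u * ip (br x u) u) = 0"
  using assms
proof (induction rule: span_induct_alt)
  case (step t a y)
  obtain b c where bc: "b \<in> R" "c \<in> R" "br b c = s *\<^sub>R a" using R_bracket[OF step(1)] by blast
  have "op_trace (br Z \<circ> br (br b c)) = 0"
    using op_trace_comp_bracket[of Z b c] ad_Z_commute[OF span_base[OF bc(1)]] by simp
  then have "op_trace (br (br b c) \<circ> br Z) = 0"
    using op_trace_commute[OF linear_br linear_br, of Z "br b c"] by simp
  also have "op_trace (br (br b c) \<circ> br Z) = (\<Sum>u\<in>F. s * (rate u * ip (br a u) u))"
    unfolding op_trace_frame[OF linear_compose[OF linear_br linear_br]]
    by (simp add: sum_frame br_Z_R br_Z_F bc(3) mult.left_commute cong: sum.cong)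
  finally have "(\<Sum>u\<in>F. rate u * ip (br a u) u) = 0"
    using s_pos by (simp flip: sum_distrib_left)
  moreover have "(\<Sum>u\<in>F. rate u * ip (br (t *\<^sub>R a + y) u) u)
      = t * (\<Sum>u\<in>F. rate u * ip (br a u) u) + (\<Sum>u\<in>F. rate u * ip (br y u) u)"
    by (simp add: algebra_simps sum.distrib sum_distrib_left)
  ultimately show ?case using step by simp
qed simp

lemma ip_ad_Z: "ip (br Z X) X = (\<Sum>u\<in>F. rate u * (ip X u)\<^sup>2)"
proof -
  have "br Z X = (\<Sum>u\<in>F. (ip X u * rate u) *\<^sub>R u)"
    by (subst linear_expansion[OF linear_br]) (simp add: sum_frame br_Z_R br_Z_F cong: sum.cong)
  then show ?thesis
    by (simp add: ip_sum_right ip_commute[of _ X] power2_eq_square mult_ac)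
qed

text \<open>Squared norms of the action of \<open>su(2)\<close> on \<open>n\<close> and of the bracket of \<open>n\<close>; rescaling will
  make both arbitrarily small.\<close>
definition action_norm2 :: real where "action_norm2 = (\<Sum>a\<in>R. \<Sum>u\<in>F. \<Sum>v\<in>F. (ip (br a u) v)\<^sup>2)"
definition nil_norm2 :: real where "nil_norm2 = (\<Sum>u\<in>F. \<Sum>v\<in>F. \<Sum>w\<in>F. (ip (br u v) w)\<^sup>2)"

lemma ip_br_F_bound:
  assumes "v \<in> F"
  shows "(ip (br x v) X)\<^sup>2 \<le> (\<Sum>w\<in>F. (ip (br x v) w)\<^sup>2) * (\<Sum>w\<in>F. (ip X w)\<^sup>2)"
  unfolding parseval_within[OF F_subset br_F[OF assms], of x X]
  by (rule Cauchy_Schwarz_ineq_sum)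

text \<open>The brackets of \<open>Z\<close> with \<open>n\<close> and of \<open>su(2)\<close> with itself are computed exactly; those of
  \<open>su(2)\<close> with \<open>n\<close> and of \<open>n\<close> with itself only see the \<open>n\<close>-component of \<open>X\<close>
  and are estimated by Cauchy-Schwarz.\<close>
lemma bracket_image_bound:
  "(\<Sum>u\<in>E. \<Sum>v\<in>E. (ip (br u v) X)\<^sup>2)
     \<le> 2 * (\<Sum>u\<in>F. (rate u)\<^sup>2 * (ip X u)\<^sup>2) + 2 * s\<^sup>2 * (\<Sum>a\<in>R. (ip X a)\<^sup>2)
       + (2 * action_norm2 + nil_norm2) * (\<Sum>u\<in>F. (ip X u)\<^sup>2)"
proof -
  let ?N = "\<Sum>u\<in>F. (ip X u)\<^sup>2"
  let ?B = "\<lambda>S T. \<Sum>u\<in>S. \<Sum>v\<in>T. (ip (br u v) X)\<^sup>2"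
  have flip: "(ip (br u v) X)\<^sup>2 = (ip (br v u) X)\<^sup>2" for u v
    using br_anticommute[of u v] by simp
  have swap: "?B S T = ?B T S" for S T
    by (subst sum.swap) (simp add: flip)
  have ZF: "(\<Sum>v\<in>F. (ip (br Z v) X)\<^sup>2) = (\<Sum>u\<in>F. (rate u)\<^sup>2 * (ip X u)\<^sup>2)"
    by (simp add: br_Z_F power_mult_distrib ip_commute[of X] cong: sum.cong)
  have RR: "?B R R = 2 * s\<^sup>2 * (\<Sum>a\<in>R. (ip X a)\<^sup>2)"
    by (simp add: sum_R power_mult_distrib ip_commute[of X] algebra_simps)
  have RF: "?B R F \<le> action_norm2 * ?N"
  proof -
    have "?B R F \<le> (\<Sum>a\<in>R. \<Sum>u\<in>F. (\<Sum>v\<in>F. (ip (br a u) v)\<^sup>2) * ?N)"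
      by (intro sum_mono ip_br_F_bound)
    then show ?thesis by (simp only: action_norm2_def sum_distrib_right)
  qed
  have FF: "?B F F \<le> nil_norm2 * ?N"
  proof -
    have "?B F F \<le> (\<Sum>u\<in>F. \<Sum>v\<in>F. (\<Sum>w\<in>F. (ip (br u v) w)\<^sup>2) * ?N)"
      by (intro sum_mono ip_br_F_bound)
    then show ?thesis by (simp only: nil_norm2_def sum_distrib_right)
  qed
  have "?B E E = 2 * (\<Sum>v\<in>F. (ip (br Z v) X)\<^sup>2) + ?B R R + 2 * ?B R F + ?B F F"
    using swap[of F R] by (simp add: sum_frame sum.distrib br_Z_R flip[of _ Z])
  then show ?thesis using ZF RR RF FF by (simp add: algebra_simps)
qed

lemma square_sum_lower: "(a + b)\<^sup>2 \<ge> a\<^sup>2 / 2 - (b::real)\<^sup>2"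
proof -
  have "(a + 2 * b)\<^sup>2 \<ge> 0" by simp
  then show ?thesis by (simp add: power2_eq_square algebra_simps)
qed

text \<open>Only pairs of basis vectors in \<open>n\<close> are kept. On \<open>n\<close> the operator \<open>ad X\<close> is the sum of
  \<open>z ad Z\<close>, \<open>ad x\<close> and \<open>ad y\<close>. The symmetric parts of the first two are orthogonal
  by \<open>rate_weighted_trace\<close>, and the third is split off at the price of a factor \<open>1/2\<close>.\<close>
lemma symmetric_part_bound:
  assumes X: "X = z *\<^sub>R Z + x + y" and x: "x \<in> span R" and y: "y \<in> span F"
  shows "(\<Sum>u\<in>E. \<Sum>v\<in>E. (ip (br X u) v + ip (br X v) u)\<^sup>2)
     \<ge> 2 * z\<^sup>2 * (\<Sum>u\<in>F. (rate u)\<^sup>2)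
       + (\<Sum>u\<in>F. \<Sum>v\<in>F. (ip (br x u) v + ip (br x v) u)\<^sup>2) / 2
       - 4 * nil_norm2 * (\<Sum>u\<in>F. (ip y u)\<^sup>2)"
proof -
  define p where "p u v = ip (br x u) v + ip (br x v) u" for u v
  define q where "q u v = ip (br y u) v + ip (br y v) u" for u v
  define d where "d u v = (if u = v then 2 * z * rate u else 0)" for u v
  let ?N = "\<Sum>u\<in>F. (ip y u)\<^sup>2"
  have split: "ip (br X u) v + ip (br X v) u = (d u v + p u v) + q u v" if "u \<in> F" "v \<in> F" for u v
    using that ip_frame[of u v] ip_frame[of v u] F_subset
    by (auto simp: X p_def q_def d_def br_Z_F subset_eq)
  have q_bound: "(\<Sum>u\<in>F. \<Sum>v\<in>F. (q u v)\<^sup>2) \<le> 4 * nil_norm2 * ?N"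
  proof -
    have *: "(ip (br y u) v)\<^sup>2 \<le> ?N * (\<Sum>w\<in>F. (ip (br w u) v)\<^sup>2)" for u v
    proof -
      have "ip (br y u) v = (\<Sum>w\<in>F. ip y w * ip (br w u) v)"
        by (subst linear_expansion_within[OF linear_br_left F_subset y]) (simp add: ip_sum_left)
      then show ?thesis by (simp only: Cauchy_Schwarz_ineq_sum)
    qed
    have "(\<Sum>u\<in>F. \<Sum>v\<in>F. (ip (br y u) v)\<^sup>2) \<le> (\<Sum>u\<in>F. \<Sum>v\<in>F. ?N * (\<Sum>w\<in>F. (ip (br w u) v)\<^sup>2))"
      by (intro sum_mono *)
    also have "\<dots> = ?N * (\<Sum>u\<in>F. \<Sum>v\<in>F. \<Sum>w\<in>F. (ip (br w u) v)\<^sup>2)"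
      by (simp only: sum_distrib_left)
    also have "(\<Sum>u\<in>F. \<Sum>v\<in>F. \<Sum>w\<in>F. (ip (br w u) v)\<^sup>2) = nil_norm2"
      unfolding nil_norm2_def by (subst sum.swap[of _ F F]) (subst (2) sum.swap, rule refl)
    finally have 1: "(\<Sum>u\<in>F. \<Sum>v\<in>F. (ip (br y u) v)\<^sup>2) \<le> ?N * nil_norm2" .
    have "(q u v)\<^sup>2 \<le> 2 * (ip (br y u) v)\<^sup>2 + 2 * (ip (br y v) u)\<^sup>2" for u v
      using sum_squares_bound[of "ip (br y u) v" "ip (br y v) u"] by (simp add: q_def power2_sum)
    then have "(\<Sum>u\<in>F. \<Sum>v\<in>F. (q u v)\<^sup>2)
        \<le> (\<Sum>u\<in>F. \<Sum>v\<in>F. 2 * (ip (br y u) v)\<^sup>2 + 2 * (ip (br y v) u)\<^sup>2)"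
      by (intro sum_mono)
    also have "\<dots> = 2 * (\<Sum>u\<in>F. \<Sum>v\<in>F. (ip (br y u) v)\<^sup>2) + 2 * (\<Sum>u\<in>F. \<Sum>v\<in>F. (ip (br y v) u)\<^sup>2)"
      by (simp add: sum.distrib sum_distrib_left)
    also have "(\<Sum>u\<in>F. \<Sum>v\<in>F. (ip (br y v) u)\<^sup>2) = (\<Sum>u\<in>F. \<Sum>v\<in>F. (ip (br y u) v)\<^sup>2)"
      by (rule sum.swap)
    finally show ?thesis using 1 by (simp add: mult_ac)
  qed
  \<comment> \<open>\<open>d\<close> is diagonal, so only the diagonal of \<open>p\<close> enters.\<close>
  have cross: "(\<Sum>u\<in>F. \<Sum>v\<in>F. d u v * p u v) = 0"
  proof -
    have "(\<Sum>v\<in>F. d u v * p u v) = 4 * z * (rate u * ip (br x u) u)" if "u \<in> F" for u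
    proof -
      have "(\<Sum>v\<in>F. d u v * p u v) = (\<Sum>v\<in>F. if u = v then 2 * z * rate u * p u v else 0)"
        by (intro sum.cong) (auto simp: d_def)
      then show ?thesis using that finite_F by (simp add: p_def)
    qed
    then show ?thesis
      using rate_weighted_trace[OF x] by (simp flip: sum_distrib_left)
  qed
  have diag: "(\<Sum>u\<in>F. \<Sum>v\<in>F. (d u v)\<^sup>2) = 4 * z\<^sup>2 * (\<Sum>u\<in>F. (rate u)\<^sup>2)"
  proof -
    have "(\<Sum>v\<in>F. (d u v)\<^sup>2) = 4 * z\<^sup>2 * (rate u)\<^sup>2" if "u \<in> F" for u
    proof -
      have "(\<Sum>v\<in>F. (d u v)\<^sup>2) = (\<Sum>v\<in>F. if u = v then 4 * z\<^sup>2 * (rate u)\<^sup>2 else 0)"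
        by (intro sum.cong) (auto simp: d_def power_mult_distrib)
      then show ?thesis using that finite_F by simp
    qed
    then show ?thesis by (simp add: sum_distrib_left)
  qed
  have "(\<Sum>u\<in>F. \<Sum>v\<in>F. (ip (br X u) v + ip (br X v) u)\<^sup>2)
      \<ge> (\<Sum>u\<in>F. \<Sum>v\<in>F. (d u v + p u v)\<^sup>2 / 2 - (q u v)\<^sup>2)"
    by (intro sum_mono) (simp only: split square_sum_lower)
  moreover have "(\<Sum>u\<in>F. \<Sum>v\<in>F. (d u v + p u v)\<^sup>2 / 2 - (q u v)\<^sup>2)
      = (\<Sum>u\<in>F. \<Sum>v\<in>F. (d u v)\<^sup>2) / 2 + (\<Sum>u\<in>F. \<Sum>v\<in>F. d u v * p u v)
        + (\<Sum>u\<in>F. \<Sum>v\<in>F. (p u v)\<^sup>2) / 2 - (\<Sum>u\<in>F. \<Sum>v\<in>F. (q u v)\<^sup>2)"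
    by (simp add: power2_sum sum.distrib sum_subtractf add_divide_distrib sum_divide_distrib mult.assoc)
  moreover have "(\<Sum>u\<in>E. \<Sum>v\<in>E. (ip (br X u) v + ip (br X v) u)\<^sup>2)
      \<ge> (\<Sum>u\<in>F. \<Sum>v\<in>F. (ip (br X u) v + ip (br X v) u)\<^sup>2)"
  proof -
    have "(\<Sum>u\<in>F. \<Sum>v\<in>F. (ip (br X u) v + ip (br X v) u)\<^sup>2)
        \<le> (\<Sum>u\<in>F. \<Sum>v\<in>E. (ip (br X u) v + ip (br X v) u)\<^sup>2)"
      by (intro sum_mono sum_mono2 finite_frame F_subset) simp
    also have "\<dots> \<le> (\<Sum>u\<in>E. \<Sum>v\<in>E. (ip (br X u) v + ip (br X v) u)\<^sup>2)"
      by (intro sum_mono2 finite_frame F_subset sum_nonneg) simp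
    finally show ?thesis .
  qed
  ultimately show ?thesis using q_bound cross diag by (simp add: p_def)
qed

text \<open>The first hypothesis makes the Ricci form negative on \<open>su(2)\<close>, where the competing
  positive term is \<open>s\<^sup>2 |x|\<^sup>2 / 2\<close>. The second makes it negative on \<open>n\<close>: half of the mean
  curvature term absorbs \<open>(rate u)\<^sup>2 / 2\<close>, and the other half absorbs the quadratic
  structure constants.\<close>
lemma negative_ricciI:
  assumes su2_stretched: "\<And>x. x \<in> span R \<Longrightarrow> x \<noteq> 0 \<Longrightarrow>
      4 * s\<^sup>2 * ip x x < (\<Sum>u\<in>F. \<Sum>v\<in>F. (ip (br x u) v + ip (br x v) u)\<^sup>2)"
    and small: "\<And>u. u \<in> F \<Longrightarrow> action_norm2 / 2 + 5 / 4 * nil_norm2 < (\<Sum>v\<in>F. rate v) * rate u / 2"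
  shows "negative_ricci br ip"
  unfolding negative_ricci_def
proof (intro allI impI)
  fix X :: 'a assume "X \<noteq> 0"
  define z where "z = ip X Z"
  define x where "x = (\<Sum>a\<in>R. ip X a *\<^sub>R a)"
  define y where "y = (\<Sum>u\<in>F. ip X u *\<^sub>R u)"
  let ?h = "\<Sum>v\<in>F. rate v"
  let ?P = "\<Sum>u\<in>F. \<Sum>v\<in>F. (ip (br x u) v + ip (br x v) u)\<^sup>2"
  have X: "X = z *\<^sub>R Z + x + y"
    using frame_expansion[of X] by (simp add: sum_frame x_def y_def z_def)
  have x: "x \<in> span R" and y: "y \<in> span F"
    unfolding x_def y_def by (intro span_sum span_scale span_base; assumption)+
  have ip_y: "ip y u = ip X u" if "u \<in> F" for u
  proof -
    have "ip x u = 0" "ip Z u = 0"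
      using that ip_orthogonal_span[OF R_subset x, of u] frame_distinct F_subset ip_frame[of Z u] Z_in
      by (auto simp: R_def)
    then show ?thesis by (simp add: X)
  qed
  have ip_x: "ip x a = ip X a" if "a \<in> R" for a
  proof -
    have "ip y a = 0" "ip Z a = 0"
      using that ip_orthogonal_span[OF F_subset y, of a] frame_distinct R_subset ip_frame[of Z a] Z_in
      by (auto simp: R_def)
    then show ?thesis by (simp add: X)
  qed
  have xx: "(\<Sum>a\<in>R. (ip X a)\<^sup>2) = ip x x"
    using parseval_within[OF R_subset x, of x] by (simp add: ip_x power2_eq_square cong: sum.cong)
  have Ny: "(\<Sum>u\<in>F. (ip y u)\<^sup>2) = (\<Sum>u\<in>F. (ip X u)\<^sup>2)"
    by (simp add: ip_y cong: sum.cong)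
  define c where "c u = action_norm2 / 2 + 5 / 4 * nil_norm2 + (rate u)\<^sup>2 / 2 - ?h * rate u" for u
  have c_neg: "c u < 0" if "u \<in> F" for u
  proof -
    have "rate u \<le> ?h"
      using that rate_pos finite_F by (intro member_le_sum) (auto intro: less_imp_le)
    then have "(rate u)\<^sup>2 \<le> ?h * rate u"
      using rate_pos[OF that] by (simp add: power2_eq_square)
    then show ?thesis using small[OF that] by (simp add: c_def)
  qed
  have c_sum: "(\<Sum>u\<in>F. c u * (ip X u)\<^sup>2) =
      (action_norm2 / 2 + 5 / 4 * nil_norm2) * (\<Sum>u\<in>F. (ip X u)\<^sup>2) + (\<Sum>u\<in>F. (rate u)\<^sup>2 * (ip X u)\<^sup>2) / 2
      - ?h * (\<Sum>u\<in>F. rate u * (ip X u)\<^sup>2)"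
  proof -
    have "(\<Sum>u\<in>F. (k + (rate u)\<^sup>2 / 2 - h * rate u) * (ip X u)\<^sup>2) =
        k * (\<Sum>u\<in>F. (ip X u)\<^sup>2) + (\<Sum>u\<in>F. (rate u)\<^sup>2 * (ip X u)\<^sup>2) / 2
        - h * (\<Sum>u\<in>F. rate u * (ip X u)\<^sup>2)" for k h
      by (simp add: algebra_simps sum.distrib sum_subtractf sum_divide_distrib sum_distrib_left)
    then show ?thesis unfolding c_def .
  qed
  have bound: "ip (ricci_op br ip X) X \<le>
      (s\<^sup>2 * ip x x / 2 - ?P / 8) - z\<^sup>2 * (\<Sum>u\<in>F. (rate u)\<^sup>2) / 2 + (\<Sum>u\<in>F. c u * (ip X u)\<^sup>2)"
  proof -
    have "ip (br (?h *\<^sub>R Z) X) X = ?h * (\<Sum>u\<in>F. rate u * (ip X u)\<^sup>2)"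
      using ip_ad_Z[of X] by simp
    moreover have "(1/4) * B - (1/4) * T - h * G
        \<le> (s\<^sup>2 * Q / 2 - P / 8) - z\<^sup>2 * W / 2 + ((action_norm2 / 2 + 5 / 4 * nil_norm2) * N + V / 2 - h * G)"
      if "B \<le> 2 * V + 2 * s\<^sup>2 * Q + (2 * action_norm2 + nil_norm2) * N"
        and "2 * z\<^sup>2 * W + P / 2 - 4 * nil_norm2 * N \<le> T" for B T V G N P Q W h
    proof -
      have "B / 4 \<le> V / 2 + s\<^sup>2 * Q / 2 + (action_norm2 / 2 + nil_norm2 / 4) * N"
        "z\<^sup>2 * W / 2 + P / 8 - nil_norm2 * N \<le> T / 4"
        using that by (simp_all add: field_simps)
      moreover have "(action_norm2 / 2 + nil_norm2 / 4) * N + nil_norm2 * N = (action_norm2 / 2 + 5 / 4 * nil_norm2) * N"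
        by (simp add: field_simps)
      ultimately show ?thesis by linarith
    qed
    note this[OF bracket_image_bound[of X, unfolded xx] symmetric_part_bound[OF X x y, unfolded Ny]]
    ultimately show ?thesis
      unfolding ricci_quadratic mean_curvature c_sum by (simp only:)
  qed
  have 1: "s\<^sup>2 * ip x x / 2 - ?P / 8 < 0" if "x \<noteq> 0"
    using su2_stretched[OF x that] by linarith
  have "0 \<le> ?P" by (intro sum_nonneg) simp
  then have 0: "s\<^sup>2 * ip x x / 2 - ?P / 8 \<le> 0"
  proof (cases "x = 0")
    case True
    then have "s\<^sup>2 * ip x x = 0" by simp
    then show ?thesis using \<open>0 \<le> ?P\<close> by linarith
  qed (use 1 in linarith)
  have rates: "(\<Sum>u\<in>F. (rate u)\<^sup>2) > 0"
    using F_nonempty finite_F rate_pos by (intro sum_pos) force+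
  have 2: "z\<^sup>2 * (\<Sum>u\<in>F. (rate u)\<^sup>2) / 2 \<ge> 0" "z \<noteq> 0 \<Longrightarrow> z\<^sup>2 * (\<Sum>u\<in>F. (rate u)\<^sup>2) / 2 > 0"
    using rates by simp_all
  have nonpos: "c u * (ip X u)\<^sup>2 \<le> 0" if "u \<in> F" for u
    using c_neg[OF that] by (simp add: mult_nonpos_nonneg)
  have 3: "(\<Sum>u\<in>F. c u * (ip X u)\<^sup>2) \<le> 0" by (intro sum_nonpos nonpos)
  have 4: "(\<Sum>u\<in>F. c u * (ip X u)\<^sup>2) < 0" if "y \<noteq> 0"
  proof -
    obtain u where u: "u \<in> F" "ip X u \<noteq> 0"
      using \<open>y \<noteq> 0\<close> unfolding y_def by (metis (mono_tags, lifting) scaleR_zero_left sum.neutral)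
    have "c u * (ip X u)\<^sup>2 < 0" using c_neg[OF u(1)] u(2) by (simp add: mult_neg_pos)
    moreover have "(\<Sum>v\<in>F - {u}. c v * (ip X v)\<^sup>2) \<le> 0" by (intro sum_nonpos nonpos) auto
    ultimately show ?thesis using sum.remove[OF finite_F u(1), of "\<lambda>u. c u * (ip X u)\<^sup>2"] by simp
  qed
  have "x \<noteq> 0 \<or> z \<noteq> 0 \<or> y \<noteq> 0" using \<open>X \<noteq> 0\<close> X by auto
  then show "ip (ricci_op br ip X) X < 0"
    using bound 0 1 2 3 4 by linarith
qed

end

section \<open>No nonzero element of su(2) acts triangularly\<close>

text \<open>If \<open>B\<close> vanishes strictly beyond a diagonal parallel to the main one, on the side where
  the triangular matrix \<open>T\<close> vanishes, then on that diagonal and beyond it the commutator with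
  \<open>T\<close> acts entrywise, multiplying by differences of diagonal entries of \<open>T\<close>.\<close>
lemma commutator_top_entry:
  fixes T B :: "'b \<Rightarrow> 'b \<Rightarrow> real" and idx :: "'b \<Rightarrow> nat"
  assumes F: "finite F" "inj_on idx F"
    and T: "\<And>u v. u \<in> F \<Longrightarrow> v \<in> F \<Longrightarrow> idx v < idx u \<Longrightarrow> T u v = 0"
    and B: "\<And>u v. u \<in> F \<Longrightarrow> v \<in> F \<Longrightarrow> m < int (idx u) - int (idx v) \<Longrightarrow> B u v = 0"
    and uv: "u \<in> F" "v \<in> F" "m \<le> int (idx u) - int (idx v)"
  shows "(\<Sum>w\<in>F. T u w * B w v - B u w * T w v) = (T u u - T v v) * B u v"
proof -
  have "(\<Sum>w\<in>F. T u w * B w v) = (\<Sum>w\<in>F. if w = u then T u u * B u v else 0)"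
  proof (intro sum.cong refl)
    fix w assume w: "w \<in> F"
    have "idx w \<noteq> idx u" if "w \<noteq> u" using that w uv F by (auto dest: inj_onD)
    then show "T u w * B w v = (if w = u then T u u * B u v else 0)"
      using T[of u w] B[of w v] w uv by (cases "idx w < idx u") auto
  qed
  moreover have "(\<Sum>w\<in>F. B u w * T w v) = (\<Sum>w\<in>F. if w = v then B u v * T v v else 0)"
  proof (intro sum.cong refl)
    fix w assume w: "w \<in> F"
    have "idx w \<noteq> idx v" if "w \<noteq> v" using that w uv F by (auto dest: inj_onD)
    then show "B u w * T w v = (if w = v then B u v * T v v else 0)"
      using T[of w v] B[of u w] w uv by (cases "idx v < idx w") auto
  qed
  ultimately show ?thesis
    using F uv by (simp add: sum_subtractf algebra_simps)
qed

text \<open>\<open>C\<close> is \<open>[T, B]\<close>, and the assumption on it reads \<open>[T, [T, B]] = - c B\<close>. At a nonzero entry of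
  \<open>B\<close> on an extreme diagonal, the double commutator multiplies by a square, which cannot be
  \<open>- c\<close>.\<close>
lemma triangular_no_rotation:
  fixes T B C :: "'b \<Rightarrow> 'b \<Rightarrow> real" and idx :: "'b \<Rightarrow> nat"
  assumes F: "finite F" "inj_on idx F"
    and T: "\<And>u v. u \<in> F \<Longrightarrow> v \<in> F \<Longrightarrow> idx v < idx u \<Longrightarrow> T u v = 0"
    and C: "\<And>u v. u \<in> F \<Longrightarrow> v \<in> F \<Longrightarrow> C u v = (\<Sum>w\<in>F. T u w * B w v - B u w * T w v)"
    and D: "\<And>u v. u \<in> F \<Longrightarrow> v \<in> F \<Longrightarrow> - c * B u v = (\<Sum>w\<in>F. T u w * C w v - C u w * T w v)"
    and c: "c > 0"
  shows "u \<in> F \<Longrightarrow> v \<in> F \<Longrightarrow> B u v = 0"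
proof (rule ccontr)
  assume uv: "u \<in> F" "v \<in> F" "B u v \<noteq> 0"
  define \<delta> where "\<delta> p = int (idx (fst p)) - int (idx (snd p))" for p
  define P where "P = {p \<in> F \<times> F. B (fst p) (snd p) \<noteq> 0}"
  have P: "finite P" "P \<noteq> {}" using F uv by (auto simp: P_def)
  obtain p where p: "p \<in> P" "\<And>q. q \<in> P \<Longrightarrow> \<delta> q \<le> \<delta> p"
  proof -
    have "Max (\<delta> ` P) \<in> \<delta> ` P" using P by (intro Max_in) auto
    then obtain p where "p \<in> P" "\<delta> p = Max (\<delta> ` P)" by auto
    then show ?thesis using P by (intro that[of p]) auto
  qed
  obtain a b where ab: "p = (a, b)" by fastforce
  have aF: "a \<in> F" "b \<in> F" "B a b \<noteq> 0" using p(1) ab by (auto simp: P_def)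
  have B0: "B u v = 0" if "u \<in> F" "v \<in> F" "\<delta> p < int (idx u) - int (idx v)" for u v
    using p(2)[of "(u, v)"] that by (auto simp: P_def \<delta>_def)
  have top: "C u v = (T u u - T v v) * B u v"
    if "u \<in> F" "v \<in> F" "\<delta> p \<le> int (idx u) - int (idx v)" for u v
    using commutator_top_entry[where T = T and B = B, OF F T B0] C that by simp
  have C0: "C u v = 0" if "u \<in> F" "v \<in> F" "\<delta> p < int (idx u) - int (idx v)" for u v
    using top[of u v] B0[of u v] that by simp
  have "- c * B a b = (T a a - T b b) * C a b"
    using commutator_top_entry[where T = T and B = C, OF F T C0] D aF by (simp add: \<delta>_def ab)
  also have "C a b = (T a a - T b b) * B a b" using top[of a b] aF by (simp add: \<delta>_def ab)
  finally have "(c + (T a a - T b b)\<^sup>2) * B a b = 0" by (simp add: algebra_simps power2_eq_square)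
  moreover have "c + (T a a - T b b)\<^sup>2 > 0" using c by (simp add: add_pos_nonneg)
  ultimately show False using aF by simp
qed

context su2_frame
begin

lemma annihilates_span: "(\<And>v. v \<in> F \<Longrightarrow> br y v = 0) \<Longrightarrow> v \<in> span F \<Longrightarrow> br y v = 0"
  using linear_eq_0_on_span[OF linear_br] by blast

lemma span_R_coords:
  assumes "x \<in> span R"
  obtains a b c where "x = a *\<^sub>R e1 + b *\<^sub>R e2 + c *\<^sub>R e3"
  using frame_expansion_within[OF R_subset assms] by (simp add: sum_R)

text \<open>In cross product notation, and up to the factor \<open>s\<^sup>3\<close>, this is \<open>x \<times> (x \<times> y) = - |x|\<^sup>2 y\<close> for \<open>y = x \<times> w\<close>, which is
  orthogonal to \<open>x\<close>.\<close>
lemma double_bracket_su2: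
  assumes "x = a *\<^sub>R e1 + b *\<^sub>R e2 + c *\<^sub>R e3" "w \<in> R"
  shows "br x (br x (br x w)) = - (s\<^sup>2 * (a\<^sup>2 + b\<^sup>2 + c\<^sup>2)) *\<^sub>R br x w"
  using assms(2) unfolding assms(1)
  by (auto simp: R_def algebra_simps power2_eq_square)

text \<open>A triangular \<open>x\<close> forces every \<open>[x, w]\<close> to act trivially on \<open>n\<close>, by
  \<open>triangular_no_rotation\<close>. The elements acting trivially form an ideal, and brackets with
  the \<open>[x, w]\<close> then produce all of \<open>su(2)\<close>, as it must be for a simple Lie algebra.\<close>
lemma triangular_su2_trivial:
  fixes idx :: "'a \<Rightarrow> nat"
  assumes inj: "inj_on idx F" and x: "x \<in> span R" "x \<noteq> 0"
    and tri: "\<And>u v. u \<in> F \<Longrightarrow> v \<in> F \<Longrightarrow> idx v < idx u \<Longrightarrow> ip (br x v) u = 0"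
    and "a \<in> R" "v \<in> F"
  shows "br a v = 0"
proof -
  obtain \<alpha> \<beta> \<gamma> where x_eq: "x = \<alpha> *\<^sub>R e1 + \<beta> *\<^sub>R e2 + \<gamma> *\<^sub>R e3"
    using span_R_coords[OF x(1)] .
  have nz: "\<alpha> \<noteq> 0 \<or> \<beta> \<noteq> 0 \<or> \<gamma> \<noteq> 0" using x_eq x(2) by auto
  define c where "c = s\<^sup>2 * (\<alpha>\<^sup>2 + \<beta>\<^sup>2 + \<gamma>\<^sup>2)"
  have "\<alpha>\<^sup>2 + \<beta>\<^sup>2 + \<gamma>\<^sup>2 > 0"
    using nz by (smt (verit) zero_le_power2 zero_less_power2)
  then have c: "c > 0" using s_pos by (simp add: c_def)
  \<comment> \<open>The matrix of \<open>ad [x, y]\<close> on \<open>n\<close> is the commutator of those of \<open>ad x\<close> and \<open>ad y\<close>.\<close>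
  have ad_entry: "ip (br (br x y) v) u
      = (\<Sum>w\<in>F. ip (br x w) u * ip (br y v) w - ip (br y w) u * ip (br x v) w)"
    if "u \<in> F" "v \<in> F" for y u v
  proof -
    have *: "ip (br y (br z v)) u = (\<Sum>w\<in>F. ip (br y w) u * ip (br z v) w)" for y z
      using linear_expansion_within[OF linear_br F_subset br_F[OF that(2)], of y z]
      by (simp add: ip_sum_left mult.commute)
    show ?thesis by (simp add: jacobi * sum_subtractf)
  qed
  define A where "A = {y. \<forall>v\<in>F. br y v = 0}"
  have A_rotated: "br x w \<in> A" if "w \<in> R" for w
  proof -
    let ?y = "br x w"
    have 3: "br x (br x ?y) = - c *\<^sub>R ?y"
      using double_bracket_su2[OF x_eq that] by (simp add: c_def)
    have zero: "ip (br ?y v) u = 0" if "u \<in> F" "v \<in> F" for u v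
    proof (rule triangular_no_rotation[where T = "\<lambda>u v. ip (br x v) u" and B = "\<lambda>u v. ip (br ?y v) u"
          and C = "\<lambda>u v. ip (br (br x ?y) v) u" and c = c, OF finite_F inj])
      show "- c * ip (br ?y v) u =
         (\<Sum>w\<in>F. ip (br x w) u * ip (br (br x ?y) v) w - ip (br (br x ?y) w) u * ip (br x v) w)"
        if "u \<in> F" "v \<in> F" for u v
        using ad_entry[OF that, of "br x ?y"] by (simp add: 3)
    qed (use tri ad_entry c that in auto)
    have "br ?y v = 0" if "v \<in> F" for v
      using frame_expansion_within[OF F_subset br_F[OF that, of ?y]] zero that by simp
    then show ?thesis by (simp add: A_def)
  qed
  have A_ideal: "br w y \<in> A" if "y \<in> A" for w y
    using that annihilates_span[of y] br_F by (auto simp: A_def jacobi)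
  have A_scale: "y \<in> A" if "t *\<^sub>R y \<in> A" "t \<noteq> 0" for t y
    using that by (auto simp: A_def)
  have "{e1, e2} \<subseteq> A \<or> {e2, e3} \<subseteq> A \<or> {e3, e1} \<subseteq> A"
  proof -
    have 1: "br x e1 \<in> A" and 2: "br x e2 \<in> A" and 3: "br x e3 \<in> A"
      using A_rotated by (auto simp: R_def)
    have "(- s\<^sup>2 * \<beta>) *\<^sub>R e1 \<in> A" "(- s\<^sup>2 * \<gamma>) *\<^sub>R e1 \<in> A"
      using A_ideal[OF 1, of e2] A_ideal[OF 1, of e3] by (simp_all add: x_eq power2_eq_square mult_ac)
    moreover have "(- s\<^sup>2 * \<alpha>) *\<^sub>R e2 \<in> A" "(- s\<^sup>2 * \<gamma>) *\<^sub>R e2 \<in> A"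
      using A_ideal[OF 2, of e1] A_ideal[OF 2, of e3] by (simp_all add: x_eq power2_eq_square mult_ac)
    moreover have "(- s\<^sup>2 * \<alpha>) *\<^sub>R e3 \<in> A" "(- s\<^sup>2 * \<beta>) *\<^sub>R e3 \<in> A"
      using A_ideal[OF 3, of e1] A_ideal[OF 3, of e2] by (simp_all add: x_eq power2_eq_square mult_ac)
    moreover have "y \<in> A" if "(- s\<^sup>2 * t) *\<^sub>R y \<in> A" "t \<noteq> 0" for t y
      using A_scale[OF that(1)] that(2) s_pos by simp
    ultimately show ?thesis using nz by blast
  qed
  moreover have "y \<in> A" if "s *\<^sub>R y \<in> A" for y
    using A_scale[OF that] s_pos by simp
  ultimately have "R \<subseteq> A"
    using A_ideal[of e2 e1] A_ideal[of e3 e2] A_ideal[of e1 e3] by (auto simp: R_def)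
  then show ?thesis using \<open>a \<in> R\<close> \<open>v \<in> F\<close> by (auto simp: A_def)
qed

end

section \<open>Rescaling an adapted basis\<close>

text \<open>By homogeneity it suffices to compare \<open>p\<close> and \<open>q\<close> on the compact unit sphere of \<open>W\<close>.\<close>
lemma quadratic_domination:
  fixes p q :: "'a::euclidean_space \<Rightarrow> real"
  assumes W: "subspace W"
    and cont: "continuous_on UNIV p" "continuous_on UNIV q"
    and hom: "\<And>c x. p (c *\<^sub>R x) = c\<^sup>2 * p x" "\<And>c x. q (c *\<^sub>R x) = c\<^sup>2 * q x"
    and pos: "\<And>x. x \<in> W \<Longrightarrow> x \<noteq> 0 \<Longrightarrow> p x > 0"
  shows "\<exists>C>0. \<forall>x\<in>W. q x \<le> C * p x"
proof -
  define K where "K = W \<inter> sphere 0 1"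
  have K: "compact K"
    unfolding K_def by (intro closed_Int_compact closed_subspace W compact_sphere)
  have p_pos: "p x > 0" if "x \<in> K" for x
    using that pos[of x] by (cases "x = 0") (auto simp: K_def)
  have "continuous_on K (\<lambda>x. q x / p x)"
    using p_pos by (intro continuous_on_divide continuous_on_subset[OF cont(1)] continuous_on_subset[OF cont(2)]) force+
  then have "bounded ((\<lambda>x. q x / p x) ` K)"
    using K compact_continuous_image compact_imp_bounded by blast
  then obtain C where C: "C > 0" "\<And>x. x \<in> K \<Longrightarrow> \<bar>q x / p x\<bar> \<le> C"
    unfolding bounded_pos by auto
  have "q x \<le> C * p x" if "x \<in> W" for x
  proof (cases "x = 0")
    case True
    then show ?thesis using hom(1)[of 0 0] hom(2)[of 0 0] by simp
  next
    case False
    let ?y = "(1 / norm x) *\<^sub>R x"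
    have y: "?y \<in> K" using that False W by (simp add: K_def subspace_scale)
    then have "q ?y \<le> C * p ?y" using C(2)[OF y] p_pos[OF y] by (simp add: abs_le_iff divide_le_eq)
    then have "(norm x)\<^sup>2 * q ?y \<le> (norm x)\<^sup>2 * (C * p ?y)" by (intro mult_left_mono) auto
    then show ?thesis
      using hom(1)[of "norm x" ?y] hom(2)[of "norm x" ?y] False by (simp add: mult_ac)
  qed
  then show ?thesis using C(1) by blast
qed

context orthonormal_frame
begin

text \<open>The inner product for which the vectors \<open>w b *\<^sub>R b\<close> with \<open>b \<in> E\<close> are orthonormal.\<close>
definition rescaled :: "('a \<Rightarrow> real) \<Rightarrow> 'a \<Rightarrow> 'a \<Rightarrow> real" where
  "rescaled w x y = (\<Sum>b\<in>E. ip x b * ip y b / (w b)\<^sup>2)"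

lemma rescaled_right:
  assumes "b \<in> E" "w b > 0"
  shows "rescaled w x (w b *\<^sub>R b) = ip x b / w b"
proof -
  have "rescaled w x (w b *\<^sub>R b) = (\<Sum>c\<in>E. if c = b then ip x b / w b else 0)"
    unfolding rescaled_def using assms
    by (intro sum.cong) (auto simp: ip_frame power2_eq_square)
  then show ?thesis using assms finite_frame by simp
qed

lemma rescaled_frame:
  assumes w: "\<And>b. b \<in> E \<Longrightarrow> w b > 0"
  shows "orthonormal_frame (rescaled w) ((\<lambda>b. w b *\<^sub>R b) ` E)" and "inj_on (\<lambda>b. w b *\<^sub>R b) E"
proof -
  let ?g = "\<lambda>b. w b *\<^sub>R b"
  have delta: "rescaled w (?g b) (?g c) = (if b = c then 1 else 0)" if "b \<in> E" "c \<in> E" for b c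
    using rescaled_right[of c w "?g b"] w[OF that(2)] that by (auto simp: ip_frame)
  show inj: "inj_on ?g E"
    by (rule inj_onI) (metis delta zero_neq_one)
  have "inner_product (rescaled w)"
    unfolding inner_product_def
  proof (intro conjI allI impI)
    have "rescaled w = (\<lambda>x y. \<Sum>b\<in>E. (ip x b / w b) * (ip y b / w b))"
      by (intro ext) (simp add: rescaled_def power2_eq_square)
    moreover have "bilinear (\<lambda>x y. \<Sum>b\<in>E. (ip x b / w b) * (ip y b / w b))"
      by (rule bilinear_sum_of_products[where f = "\<lambda>b x. ip x b / w b"])
         (simp add: linear_iff add_divide_distrib)
    ultimately show "bilinear (rescaled w)" by simp
    show "rescaled w x y = rescaled w y x" for x y
      by (simp add: rescaled_def mult.commute)
    show "rescaled w x x > 0" if "x \<noteq> 0" for x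
    proof -
      have "\<exists>b\<in>E. ip x b \<noteq> 0"
      proof (rule ccontr)
        assume "\<not> ?thesis"
        then have "(\<Sum>b\<in>E. ip x b *\<^sub>R b) = 0" by (intro sum.neutral) auto
        then show False using frame_expansion[of x] that by simp
      qed
      then obtain b where b: "b \<in> E" "ip x b \<noteq> 0" by blast
      have "w b > 0" using w b(1) by blast
      then show ?thesis
        unfolding rescaled_def power2_eq_square[symmetric] using b finite_frame
        by (intro sum_pos2[of _ b]) auto
    qed
  qed
  moreover have "span (?g ` E) = UNIV"
  proof -
    have "b \<in> span (?g ` E)" if "b \<in> E" for b
    proof -
      have "(1 / w b) *\<^sub>R ?g b \<in> span (?g ` E)" using that by (intro span_scale span_base imageI)
      then show ?thesis using w[OF that] by simp
    qed
    then have "span E \<subseteq> span (?g ` E)" by (intro span_minimal subsetI subspace_span)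
    then show ?thesis using span_frame by auto
  qed
  ultimately show "orthonormal_frame (rescaled w) (?g ` E)"
    using delta by unfold_locales (auto simp: orthonormal_basis_def inj_on_eq_iff[OF inj])
qed

end

context su2_frame
begin

text \<open>The entry of \<open>ad x\<close> at a pair \<open>u, v\<close> changes by \<open>\<rho> v / \<rho> u\<close> when each \<open>u\<close> is divided by
  \<open>\<rho> u\<close>. With \<open>\<rho> u = \<tau> ^ idx u\<close> this is at least \<open>\<tau>\<close> if \<open>idx u < idx v\<close>, while the
  opposite entry shrinks. The sum \<open>p x\<close> of the squares of the growing entries
  is positive for \<open>x \<noteq> 0\<close> by \<open>triangular_su2_trivial\<close>, hence dominates every quadratic form
  in \<open>x\<close> once multiplied by a large constant.\<close>
lemma stretching_weights:
  assumes nontrivial: "\<exists>a\<in>R. \<exists>v\<in>F. br a v \<noteq> 0"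
  obtains \<rho> :: "'a \<Rightarrow> real" where "\<And>u. \<rho> u > 0"
    and "\<And>x. x \<in> span R \<Longrightarrow> x \<noteq> 0 \<Longrightarrow>
      4 * ip x x < (\<Sum>u\<in>F. \<Sum>v\<in>F. (\<rho> v / \<rho> u * ip (br x u) v + \<rho> u / \<rho> v * ip (br x v) u)\<^sup>2)"
proof -
  obtain idx :: "'a \<Rightarrow> nat" where inj: "inj_on idx F"
    using finite_imp_inj_to_nat_seg[OF finite_F] by blast
  define p where "p x = (\<Sum>u\<in>F. \<Sum>v\<in>F. if idx u < idx v then (ip (br x u) v)\<^sup>2 else 0)" for x
  \<comment> \<open>\<open>q\<close> collects the error made by separating the growing from the shrinking entries, and
    the quantity that has to be exceeded.\<close>
  define q where "q x = (\<Sum>u\<in>F. \<Sum>v\<in>F. (ip (br x v) u)\<^sup>2) + 4 * ip x x" for x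
  have cont_entry: "continuous_on UNIV (\<lambda>x. ip (br x u) v)" for u v
    by (intro linear_continuous_on linear_linear[THEN iffD2])
       (simp add: linear_iff)
  have p_pos: "p x > 0" if x: "x \<in> span R" "x \<noteq> 0" for x
  proof (rule ccontr)
    assume "\<not> p x > 0"
    moreover have "p x \<ge> 0" unfolding p_def by (intro sum_nonneg) auto
    ultimately have "p x = 0" by simp
    then have "ip (br x u) v = 0" if "u \<in> F" "v \<in> F" "idx u < idx v" for u v
      using that finite_F by (fastforce simp: p_def sum_nonneg_eq_0_iff sum_nonneg)
    then show False using triangular_su2_trivial[OF inj x] nontrivial by blast
  qed
  have "\<exists>C>0. \<forall>x\<in>span R. q x \<le> C * p x"
  proof (rule quadratic_domination[OF subspace_span _ _ _ _ p_pos])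
    show "continuous_on UNIV p"
      unfolding p_def
    proof (intro continuous_on_sum)
      show "continuous_on UNIV (\<lambda>x. if idx u < idx v then (ip (br x u) v)\<^sup>2 else 0)" for u v
        by (cases "idx u < idx v") (simp_all add: continuous_on_power cont_entry)
    qed
    have "continuous_on UNIV (\<lambda>x. \<Sum>e\<in>E. ip x e * ip x e)"
      by (intro continuous_on_sum continuous_on_mult linear_continuous_on linear_linear[THEN iffD2] linear_ip_left)
    then have "continuous_on UNIV (\<lambda>x. ip x x)" by (simp flip: parseval)
    then show "continuous_on UNIV q"
      unfolding q_def by (intro continuous_intros cont_entry)
    show "p (c *\<^sub>R x) = c\<^sup>2 * p x" for c x
      by (simp add: p_def power_mult_distrib sum_distrib_left if_distrib cong: if_cong)
    show "q (c *\<^sub>R x) = c\<^sup>2 * q x" for c x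
      by (simp add: q_def power_mult_distrib sum_distrib_left algebra_simps power2_eq_square)
  qed
  then obtain C where C: "C > 0" "\<And>x. x \<in> span R \<Longrightarrow> q x \<le> C * p x" by blast
  \<comment> \<open>Any \<open>\<tau> \<ge> 1\<close> with \<open>\<tau>\<^sup>2 > 2 C\<close> would do.\<close>
  define \<tau> where "\<tau> = 1 + 2 * C"
  have \<tau>: "\<tau> \<ge> 1" "\<tau>\<^sup>2 / 2 > C"
  proof -
    have "\<tau>\<^sup>2 / 2 = 1 / 2 + 2 * C + 2 * C\<^sup>2" by (simp add: \<tau>_def power2_eq_square algebra_simps)
    then show "\<tau>\<^sup>2 / 2 > C" using C(1) by (simp add: add_pos_nonneg)
  qed (use C(1) in \<open>simp add: \<tau>_def\<close>)
  define \<rho> where "\<rho> u = \<tau> ^ idx u" for u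
  have \<rho>_pos: "\<rho> u > 0" for u using \<tau>(1) by (simp add: \<rho>_def)
  show thesis
  proof (rule that[of \<rho>])
    show "\<rho> u > 0" for u by (rule \<rho>_pos)
    fix x assume x: "x \<in> span R" "x \<noteq> 0"
    have entry: "(if idx u < idx v then \<tau>\<^sup>2 / 2 * (ip (br x u) v)\<^sup>2 else 0) - (ip (br x v) u)\<^sup>2
        \<le> (\<rho> v / \<rho> u * ip (br x u) v + \<rho> u / \<rho> v * ip (br x v) u)\<^sup>2" for u v
    proof (cases "idx u < idx v")
      case True
      have ratio: "\<tau> \<le> \<rho> v / \<rho> u"
      proof -
        have "\<tau> * \<rho> u = \<tau> ^ Suc (idx u)" by (simp add: \<rho>_def)
        also have "\<dots> \<le> \<rho> v" unfolding \<rho>_def using True \<tau>(1) by (intro power_increasing) auto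
        finally show ?thesis using \<rho>_pos[of u] by (simp add: le_divide_eq)
      qed
      have "\<rho> u / \<rho> v \<le> 1" "\<rho> u / \<rho> v \<ge> 0"
        using ratio \<tau>(1) \<rho>_pos[of u] \<rho>_pos[of v] by (simp_all add: field_simps) (smt (verit) mult_le_cancel_right1)
      then have "(\<rho> u / \<rho> v)\<^sup>2 \<le> 1" by (simp add: power_le_one)
      then have "(\<rho> u / \<rho> v * ip (br x v) u)\<^sup>2 \<le> (ip (br x v) u)\<^sup>2"
        unfolding power_mult_distrib by (simp add: mult_left_le_one_le)
      moreover have "\<tau>\<^sup>2 \<le> (\<rho> v / \<rho> u)\<^sup>2" using ratio \<tau>(1) by (intro power_mono) auto
      then have "\<tau>\<^sup>2 * (ip (br x u) v)\<^sup>2 \<le> (\<rho> v / \<rho> u * ip (br x u) v)\<^sup>2"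
        unfolding power_mult_distrib by (intro mult_right_mono) auto
      ultimately show ?thesis
        using True square_sum_lower[of "\<rho> v / \<rho> u * ip (br x u) v" "\<rho> u / \<rho> v * ip (br x v) u"]
        by (simp add: field_simps)
    next
      case False
      have "- (ip (br x v) u)\<^sup>2 \<le> 0" by simp
      also have "0 \<le> (\<rho> v / \<rho> u * ip (br x u) v + \<rho> u / \<rho> v * ip (br x v) u)\<^sup>2" by simp
      finally show ?thesis using False by simp
    qed
    have "4 * ip x x + (\<Sum>u\<in>F. \<Sum>v\<in>F. (ip (br x v) u)\<^sup>2) = q x" by (simp add: q_def)
    also have "\<dots> \<le> C * p x" by (rule C(2)[OF x(1)])
    also have "\<dots> < \<tau>\<^sup>2 / 2 * p x" using \<tau>(2) p_pos[OF x] by (intro mult_strict_right_mono)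
    also have "\<dots> = (\<Sum>u\<in>F. \<Sum>v\<in>F. if idx u < idx v then \<tau>\<^sup>2 / 2 * (ip (br x u) v)\<^sup>2 else 0)"
      unfolding p_def sum_distrib_left by (intro sum.cong) auto
    finally have "4 * ip x x < (\<Sum>u\<in>F. \<Sum>v\<in>F.
        (if idx u < idx v then \<tau>\<^sup>2 / 2 * (ip (br x u) v)\<^sup>2 else 0) - (ip (br x v) u)\<^sup>2)"
      by (simp add: sum_subtractf)
    also have "\<dots> \<le> (\<Sum>u\<in>F. \<Sum>v\<in>F. (\<rho> v / \<rho> u * ip (br x u) v + \<rho> u / \<rho> v * ip (br x v) u)\<^sup>2)"
      by (intro sum_mono entry)
    finally show "4 * ip x x < (\<Sum>u\<in>F. \<Sum>v\<in>F. (\<rho> v / \<rho> u * ip (br x u) v + \<rho> u / \<rho> v * ip (br x v) u)\<^sup>2)" .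
  qed
qed

text \<open>The weights of \<open>stretching_weights\<close> on \<open>n\<close> are combined with a factor \<open>\<sigma>\<close> on both \<open>su(2)\<close>
  and \<open>n\<close>. It cancels in the matrices of \<open>ad x\<close> on \<open>n\<close> for fixed \<open>x\<close>, and hence
  in the first hypothesis of \<open>negative_ricciI\<close>, while the structure constants in the
  second hypothesis are proportional to \<open>\<sigma>\<close>.\<close>
lemma ex_negative_ricci:
  assumes s1: "s = 1" and nontrivial: "\<exists>a\<in>R. \<exists>v\<in>F. br a v \<noteq> 0"
  shows "\<exists>ip'. inner_product ip' \<and> negative_ricci br ip'"
proof -
  obtain \<rho> where \<rho>: "\<And>u. \<rho> u > 0"
    and stretched: "\<And>x. x \<in> span R \<Longrightarrow> x \<noteq> 0 \<Longrightarrow>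
      4 * ip x x < (\<Sum>u\<in>F. \<Sum>v\<in>F. (\<rho> v / \<rho> u * ip (br x u) v + \<rho> u / \<rho> v * ip (br x v) u)\<^sup>2)"
    using stretching_weights[OF nontrivial] by blast
  define K1 where "K1 = (\<Sum>a\<in>R. \<Sum>u\<in>F. \<Sum>v\<in>F. (\<rho> v / \<rho> u * ip (br a u) v)\<^sup>2)"
  define K2 where "K2 = (\<Sum>u\<in>F. \<Sum>v\<in>F. \<Sum>w\<in>F. (\<rho> w / (\<rho> u * \<rho> v) * ip (br u v) w)\<^sup>2)"
  define K where "K = K1 / 2 + 5 / 4 * K2"
  have "K1 \<ge> 0" "K2 \<ge> 0" unfolding K1_def K2_def by (intro sum_nonneg; simp)+
  then have K: "K \<ge> 0" by (simp add: K_def)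
  let ?h = "\<Sum>v\<in>F. rate v"
  define \<delta> where "\<delta> = Min ((\<lambda>u. ?h * rate u / 2) ` F)"
  have h: "?h > 0" using F_nonempty finite_F rate_pos by (intro sum_pos)
  have \<delta>: "\<delta> > 0" "\<And>u. u \<in> F \<Longrightarrow> \<delta> \<le> ?h * rate u / 2"
  proof -
    have "\<delta> \<in> (\<lambda>u. ?h * rate u / 2) ` F"
      unfolding \<delta>_def by (rule Min_in) (use F_nonempty finite_F in blast)+
    then obtain u where "u \<in> F" "\<delta> = ?h * rate u / 2" by blast
    then show "\<delta> > 0" using rate_pos[of u] mult_pos_pos[OF h, of "rate u"] by linarith
    show "\<delta> \<le> ?h * rate u / 2" if "u \<in> F" for u
      unfolding \<delta>_def by (rule Min_le) (use finite_F that in blast)+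
  qed
  \<comment> \<open>Chosen so that \<open>\<sigma>\<^sup>2 K < \<delta>\<close>; the summand \<open>1\<close> covers the case \<open>K = 0\<close>.\<close>
  define \<sigma> where "\<sigma> = sqrt (\<delta> / (1 + K))"
  have \<sigma>: "\<sigma> > 0" using \<delta>(1) K by (simp add: \<sigma>_def)
  have \<sigma>K: "\<sigma>\<^sup>2 * K < \<delta>"
  proof -
    have "\<sigma>\<^sup>2 * K = \<delta> * (K / (1 + K))" using \<delta>(1) K by (simp add: \<sigma>_def)
    also have "\<dots> < \<delta> * 1" using \<delta>(1) K by (intro mult_strict_left_mono) auto
    finally show ?thesis by simp
  qed
  define w where "w b = (if b = Z then 1 else if b \<in> R then \<sigma> else \<sigma> / \<rho> b)" for b
  define g where "g b = w b *\<^sub>R b" for b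
  have w_pos: "w b > 0" for b using \<sigma> \<rho>[of b] by (simp add: w_def)
  have wZ: "w Z = 1" and wR: "\<And>a. a \<in> R \<Longrightarrow> w a = \<sigma>" and wF: "\<And>u. u \<in> F \<Longrightarrow> w u = \<sigma> / \<rho> u"
    using frame_distinct by (auto simp: w_def R_def)
  have g: "g Z = Z" "g e1 = \<sigma> *\<^sub>R e1" "g e2 = \<sigma> *\<^sub>R e2" "g e3 = \<sigma> *\<^sub>R e3"
    by (simp_all add: g_def wZ wR R_def)
  interpret n: orthonormal_frame "rescaled w" "g ` E"
    unfolding g_def using rescaled_frame(1) w_pos by blast
  have inj: "inj_on g E" unfolding g_def using rescaled_frame(2) w_pos by blast
  have resc: "rescaled w x (g b) = ip x b / w b" if "b \<in> E" for x b
    unfolding g_def using rescaled_right[OF that w_pos] .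
  have span_gF: "span F \<subseteq> span (g ` F)"
  proof -
    have "u \<in> span (g ` F)" if "u \<in> F" for u
    proof -
      have "(1 / w u) *\<^sub>R g u \<in> span (g ` F)" using that by (intro span_scale span_base imageI)
      then show ?thesis using w_pos[of u] by (simp add: g_def)
    qed
    then show ?thesis by (intro span_minimal subsetI subspace_span)
  qed
  interpret n: su2_frame "rescaled w" "g ` E" br Z "\<sigma> *\<^sub>R e1" "\<sigma> *\<^sub>R e2" "\<sigma> *\<^sub>R e3" "g ` F" \<sigma>
  proof unfold_locales
    show "lie_algebra br" by (rule lie_algebra)
    show "g ` E = {Z, \<sigma> *\<^sub>R e1, \<sigma> *\<^sub>R e2, \<sigma> *\<^sub>R e3} \<union> g ` F"
      using frame_eq g by auto
    show "distinct [Z, \<sigma> *\<^sub>R e1, \<sigma> *\<^sub>R e2, \<sigma> *\<^sub>R e3]"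
    proof -
      have "inj_on g (set [Z, e1, e2, e3])" by (rule inj_on_subset[OF inj]) (auto simp: frame_eq)
      then have "distinct (map g [Z, e1, e2, e3])" using frame_distinct(1) by (simp only: distinct_map)
      then show ?thesis by (simp only: list.map g)
    qed
    show "{Z, \<sigma> *\<^sub>R e1, \<sigma> *\<^sub>R e2, \<sigma> *\<^sub>R e3} \<inter> g ` F = {}"
      using inj_on_image_Int[OF inj, of "{Z, e1, e2, e3}" F] frame_distinct(2) by (auto simp: g frame_eq)
    show "\<exists>c>0. br Z v = c *\<^sub>R v" if "v \<in> g ` F" for v
      using that Z_eigenvector by (fastforce simp: g_def)
    show "br x v \<in> span (g ` F)" if "v \<in> g ` F" for x v
    proof -
      obtain u where u: "u \<in> F" "v = g u" using \<open>v \<in> g ` F\<close> by blast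
      have "w u *\<^sub>R br x u \<in> span (g ` F)" using br_F[OF u(1), of x] span_gF by (intro span_scale) blast
      then show ?thesis by (simp add: u g_def)
    qed
  qed (use F_nonempty \<sigma> s1 in auto)
  have nR: "n.R = g ` R" by (auto simp: n.R_def R_def g)
  have injs: "inj_on g F" "inj_on g R"
    using inj_on_subset[OF inj] F_subset R_subset by auto
  have br_g: "br x (g u) = w u *\<^sub>R br x u" "br (g u) x = w u *\<^sub>R br u x" for x u
    by (simp_all add: g_def)
  have rate: "n.rate (g u) = rate u" if "u \<in> F" for u
  proof -
    have "n.rate (g u) = ip (br Z (g u)) u / w u"
      unfolding n.rate_def by (rule resc) (use that F_subset in blast)
    then show ?thesis using w_pos[of u] by (simp add: br_g rate_def)
  qed
  have entry: "rescaled w (br x (g u)) (g v) = \<rho> v / \<rho> u * ip (br x u) v" if "u \<in> F" "v \<in> F" for x u v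
  proof -
    have "rescaled w (br x (g u)) (g v) = ip (br x (g u)) v / w v"
      by (rule resc) (use that F_subset in blast)
    also have "\<dots> = \<rho> v / \<rho> u * ip (br x u) v"
      using \<sigma> by (simp add: br_g wF that)
    finally show ?thesis .
  qed
  have action_norm2: "n.action_norm2 = \<sigma>\<^sup>2 * K1"
  proof -
    have "n.action_norm2 = (\<Sum>a\<in>R. \<Sum>u\<in>F. \<Sum>v\<in>F. (rescaled w (br (g a) (g u)) (g v))\<^sup>2)"
      by (simp add: n.action_norm2_def nR sum.reindex injs)
    also have "\<dots> = (\<Sum>a\<in>R. \<Sum>u\<in>F. \<Sum>v\<in>F. \<sigma>\<^sup>2 * (\<rho> v / \<rho> u * ip (br a u) v)\<^sup>2)"
    proof (intro sum.cong refl)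
      fix a u v assume "a \<in> R" "u \<in> F" "v \<in> F"
      then show "(rescaled w (br (g a) (g u)) (g v))\<^sup>2 = \<sigma>\<^sup>2 * (\<rho> v / \<rho> u * ip (br a u) v)\<^sup>2"
        by (simp only: br_g(2) wR n.ip_simps entry real_scaleR_def power_mult_distrib)
    qed
    finally show ?thesis by (simp add: K1_def sum_distrib_left)
  qed
  have nil_norm2: "n.nil_norm2 = \<sigma>\<^sup>2 * K2"
  proof -
    have "n.nil_norm2 = (\<Sum>u\<in>F. \<Sum>v\<in>F. \<Sum>x\<in>F. (rescaled w (br (g u) (g v)) (g x))\<^sup>2)"
      by (simp add: n.nil_norm2_def sum.reindex injs)
    also have "\<dots> = (\<Sum>u\<in>F. \<Sum>v\<in>F. \<Sum>x\<in>F. \<sigma>\<^sup>2 * (\<rho> x / (\<rho> u * \<rho> v) * ip (br u v) x)\<^sup>2)"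
    proof (intro sum.cong refl)
      fix u v x assume "u \<in> F" "v \<in> F" "x \<in> F"
      then show "(rescaled w (br (g u) (g v)) (g x))\<^sup>2 = \<sigma>\<^sup>2 * (\<rho> x / (\<rho> u * \<rho> v) * ip (br u v) x)\<^sup>2"
        by (simp only: br_g(2) wF n.ip_simps entry real_scaleR_def) (simp add: power_mult_distrib power_divide)
    qed
    finally show ?thesis by (simp add: K2_def sum_distrib_left)
  qed
  have span_nR: "span n.R = span R"
  proof -
    have "n.R = (\<lambda>x. \<sigma> *\<^sub>R x) ` R" by (auto simp: n.R_def R_def)
    then show ?thesis using span_image_scale[of R "\<lambda>_. \<sigma>"] \<sigma> finite_R by simp
  qed
  have norm_R: "\<sigma>\<^sup>2 * rescaled w x x = ip x x" if x: "x \<in> span R" for x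
  proof -
    have "\<sigma>\<^sup>2 * rescaled w x x = (\<Sum>b\<in>E. ip x b * ip x b)"
      unfolding rescaled_def sum_distrib_left
    proof (intro sum.cong refl)
      fix b assume "b \<in> E"
      then show "\<sigma>\<^sup>2 * (ip x b * ip x b / (w b)\<^sup>2) = ip x b * ip x b"
        using ip_orthogonal_span[OF R_subset x, of b] wR[of b] \<sigma> by (cases "b \<in> R") auto
    qed
    then show ?thesis using parseval[of x x] by simp
  qed
  have "negative_ricci br (rescaled w)"
  proof (rule n.negative_ricciI)
    fix x assume x: "x \<in> span n.R" "x \<noteq> 0"
    have "4 * \<sigma>\<^sup>2 * rescaled w x x = 4 * ip x x" using norm_R x span_nR by (simp add: mult.assoc)
    also have "\<dots> < (\<Sum>u\<in>F. \<Sum>v\<in>F. (\<rho> v / \<rho> u * ip (br x u) v + \<rho> u / \<rho> v * ip (br x v) u)\<^sup>2)"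
      using stretched x span_nR by simp
    also have "\<dots> = (\<Sum>u\<in>g ` F. \<Sum>v\<in>g ` F. (rescaled w (br x u) v + rescaled w (br x v) u)\<^sup>2)"
      by (simp add: sum.reindex injs entry)
    finally show "4 * \<sigma>\<^sup>2 * rescaled w x x < \<dots>" .
  next
    fix u' assume "u' \<in> g ` F"
    then obtain u where u: "u \<in> F" "u' = g u" by blast
    have "(\<Sum>v\<in>g ` F. n.rate v) = ?h" by (simp add: sum.reindex injs rate)
    moreover have "n.action_norm2 / 2 + 5 / 4 * n.nil_norm2 = \<sigma>\<^sup>2 * K" by (simp add: action_norm2 nil_norm2 K_def algebra_simps)
    ultimately show "n.action_norm2 / 2 + 5 / 4 * n.nil_norm2 < (\<Sum>v\<in>g ` F. n.rate v) * n.rate u' / 2"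
      using \<sigma>K \<delta>(2)[OF u(1)] u by (simp add: rate)
  qed
  then show ?thesis using n.inner_product by blast
qed

end

section \<open>An adapted basis of the given Lie algebra\<close>
lemma independent_Un_complementary:
  assumes A: "independent A" and B: "independent B"
    and disj: "span A \<inter> span B = {0::'a::euclidean_space}"
  shows "independent (A \<union> B)" "A \<inter> B = {}"
proof -
  show AB: "A \<inter> B = {}"
  proof -
    have False if x: "x \<in> A" "x \<in> B" for x
    proof -
      have "x \<in> span A \<inter> span B" using x by (simp add: span_base)
      then have "x = 0" using disj by simp
      then show False using x(1) A dependent_zero by blast
    qed
    then show ?thesis by blast
  qed
  have fin: "finite A" "finite B" using A B finiteI_independent by auto
  show "independent (A \<union> B)"
  proof (rule independent_if_scalars_zero)
    fix f x assume sum: "(\<Sum>x\<in>A \<union> B. f x *\<^sub>R x) = 0" and x: "x \<in> A \<union> B"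
    let ?a = "\<Sum>x\<in>A. f x *\<^sub>R x" and ?b = "\<Sum>x\<in>B. f x *\<^sub>R x"
    have ab: "?a + ?b = 0" using sum fin AB by (simp add: sum.union_disjoint)
    have "?a \<in> span A" "?b \<in> span B" by (intro span_sum span_scale span_base; assumption)+
    moreover have "?a = - ?b" using ab by (simp add: eq_neg_iff_add_eq_0)
    ultimately have "?a \<in> span A \<inter> span B" by (simp add: span_neg)
    then have "?a = 0" "?b = 0" using disj ab by auto
    then show "f x = 0"
      using independentD[OF A fin(1) order_refl, of f x] independentD[OF B fin(2) order_refl, of f x] x by blast
  qed (use fin in simp)
qed

lemma ex_orthonormal_frame:
  assumes "independent E" "span E = (UNIV :: 'a::euclidean_space set)"
  shows "\<exists>ip. orthonormal_frame ip E"
proof -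
  define ip where "ip x y = (\<Sum>b\<in>E. representation E x b * representation E y b)" for x y
  have fin: "finite E" using assms(1) finiteI_independent by blast
  have lin: "linear (\<lambda>x. representation E x b)" for b
    using assms by (simp add: linear_iff representation_add representation_scale)
  have "bilinear (\<lambda>x y. \<Sum>b\<in>E. representation E x b * representation E y b)"
    by (rule bilinear_sum_of_products[where f = "\<lambda>b x. representation E x b"]) (rule lin)
  then have "bilinear ip" by (simp add: ip_def[abs_def])
  moreover have "ip x x > 0" if "x \<noteq> 0" for x
  proof -
    have "(\<Sum>b\<in>E. representation E x b *\<^sub>R b) = x"
      using assms fin by (intro sum_representation_eq) auto
    then have "\<exists>b\<in>E. representation E x b \<noteq> 0"
      using that sum.neutral[of E "\<lambda>b. representation E x b *\<^sub>R b"] by force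
    then obtain b where "b \<in> E" "representation E x b \<noteq> 0" by blast
    then show ?thesis
      unfolding ip_def power2_eq_square[symmetric] using fin by (intro sum_pos2[of _ b]) auto
  qed
  moreover have "ip u v = (if u = v then 1 else 0)" if "u \<in> E" "v \<in> E" for u v
  proof -
    have "ip u v = (\<Sum>b\<in>E. if b = u then (if u = v then 1 else 0) else 0)"
      unfolding ip_def using that by (intro sum.cong) (auto simp: representation_basis[OF assms(1)])
    then show ?thesis using that fin by simp
  qed
  ultimately have "orthonormal_frame ip E"
    using assms(2) by unfold_locales (auto simp: inner_product_def orthonormal_basis_def ip_def mult.commute)
  then show ?thesis by blast
qed

text \<open>The matrices \<open>A1, A2, A3\<close> are the Pauli matrices \<open>\<sigma>\<^sub>z, \<sigma>\<^sub>y, \<sigma>\<^sub>x\<close> multiplied by \<open>\<i> / 2\<close>; this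
  factor and this order give the cross product brackets without signs or constants.\<close>
lemma su2_standard_basis:
  assumes "isomorphic_su2 br S"
  obtains X1 X2 X3 where "br X1 X2 = X3" "br X2 X3 = X1" "br X3 X1 = X2"
    "span {X1, X2, X3} = S" "independent {X1, X2, X3}" "distinct [X1, X2, X3]"
proof -
  obtain \<phi> :: "complex^2^2 \<Rightarrow> 'a" where bij: "bij_betw \<phi> su2 S"
    and add: "\<And>A B. A \<in> su2 \<Longrightarrow> B \<in> su2 \<Longrightarrow> \<phi> (A + B) = \<phi> A + \<phi> B"
    and scale: "\<And>c A. A \<in> su2 \<Longrightarrow> \<phi> ((c::real) *\<^sub>R A) = c *\<^sub>R \<phi> A"
    and br: "\<And>A B. A \<in> su2 \<Longrightarrow> B \<in> su2 \<Longrightarrow> \<phi> (A ** B - B ** A) = br (\<phi> A) (\<phi> B)"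
    using assms unfolding isomorphic_su2_def by blast
  define A1 :: "complex^2^2" where "A1 = vector [vector [\<i> / 2, 0], vector [0, - \<i> / 2]]"
  define A2 :: "complex^2^2" where "A2 = vector [vector [0, 1 / 2], vector [- 1 / 2, 0]]"
  define A3 :: "complex^2^2" where "A3 = vector [vector [0, \<i> / 2], vector [\<i> / 2, 0]]"
  define comb where "comb a b c = a *\<^sub>R A1 + b *\<^sub>R A2 + c *\<^sub>R A3" for a b c :: real
  have su2_iff: "A \<in> su2 \<longleftrightarrow> cnj (A $ 1 $ 1) = - A $ 1 $ 1 \<and> cnj (A $ 2 $ 1) = - A $ 1 $ 2 \<and>
      cnj (A $ 1 $ 2) = - A $ 2 $ 1 \<and> cnj (A $ 2 $ 2) = - A $ 2 $ 2 \<and> A $ 1 $ 1 + A $ 2 $ 2 = 0" for A :: "complex^2^2"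
    by (auto simp: su2_def vec_eq_iff forall_2 trace_def sum_2)
  have comb_entries: "comb a b c $ 1 $ 1 = Complex 0 (a / 2)" "comb a b c $ 1 $ 2 = Complex (b / 2) (c / 2)"
    "comb a b c $ 2 $ 1 = Complex (- b / 2) (c / 2)" "comb a b c $ 2 $ 2 = Complex 0 (- a / 2)" for a b c
    by (simp_all add: comb_def A1_def A2_def A3_def complex_eq_iff)
  have comb_su2: "comb a b c \<in> su2" for a b c
    by (simp add: su2_iff comb_entries complex_eq_iff)
  have A_comb: "A1 = comb 1 0 0" "A2 = comb 0 1 0" "A3 = comb 0 0 1"
    by (simp_all add: comb_def)
  have A_su2: "A1 \<in> su2" "A2 \<in> su2" "A3 \<in> su2"
    unfolding A_comb by (rule comb_su2)+
  have su2_comb: "\<exists>a b c. A = comb a b c" if "A \<in> su2" for A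
  proof (intro exI)
    have "Re (A $ 1 $ 1) = 0" "Re (A $ 2 $ 2) = 0" "Im (A $ 2 $ 2) = - Im (A $ 1 $ 1)"
      "Re (A $ 2 $ 1) = - Re (A $ 1 $ 2)" "Im (A $ 2 $ 1) = Im (A $ 1 $ 2)"
      using that unfolding su2_iff complex_eq_iff cnj.sel uminus_complex.sel plus_complex.sel zero_complex.sel
      by linarith+
    then show "A = comb (2 * Im (A $ 1 $ 1)) (2 * Re (A $ 1 $ 2)) (2 * Im (A $ 1 $ 2))"
      by (simp add: vec_eq_iff forall_2 comb_entries complex_eq_iff)
  qed
  have comb_zero: "a = 0 \<and> b = 0 \<and> c = 0" if "comb a b c = 0" for a b c
    using comb_entries(1,2)[of a b c] that by (simp add: complex_eq_iff)
  have brackets: "A1 ** A2 - A2 ** A1 = A3" "A2 ** A3 - A3 ** A2 = A1" "A3 ** A1 - A1 ** A3 = A2"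
    by (simp_all add: A1_def A2_def A3_def vec_eq_iff forall_2 matrix_matrix_mult_def sum_2 complex_eq_iff)
  define X1 where "X1 = \<phi> A1"
  define X2 where "X2 = \<phi> A2"
  define X3 where "X3 = \<phi> A3"
  have \<phi>_comb: "\<phi> (comb a b c) = a *\<^sub>R X1 + b *\<^sub>R X2 + c *\<^sub>R X3" for a b c
  proof -
    have 1: "a *\<^sub>R A1 + b *\<^sub>R A2 \<in> su2" using comb_su2[of a b 0] by (simp add: comb_def)
    have 2: "a *\<^sub>R A1 \<in> su2" using comb_su2[of a 0 0] by (simp add: comb_def)
    have 3: "b *\<^sub>R A2 \<in> su2" using comb_su2[of 0 b 0] by (simp add: comb_def)
    have 4: "c *\<^sub>R A3 \<in> su2" using comb_su2[of 0 0 c] by (simp add: comb_def)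
    show ?thesis
      unfolding comb_def X1_def X2_def X3_def
      by (simp only: add[OF 1 4] add[OF 2 3] scale A_su2)
  qed
  have S_comb: "x \<in> S \<longleftrightarrow> (\<exists>a b c. x = a *\<^sub>R X1 + b *\<^sub>R X2 + c *\<^sub>R X3)" for x
  proof -
    have "x \<in> S \<longleftrightarrow> (\<exists>A\<in>su2. x = \<phi> A)" using bij unfolding bij_betw_def by blast
    also have "\<dots> \<longleftrightarrow> (\<exists>a b c. x = \<phi> (comb a b c))" using su2_comb comb_su2 by blast
    finally show ?thesis by (simp add: \<phi>_comb)
  qed
  have zero: "a = 0 \<and> b = 0 \<and> c = 0" if "a *\<^sub>R X1 + b *\<^sub>R X2 + c *\<^sub>R X3 = 0" for a b c
  proof -
    have "\<phi> (comb a b c) = \<phi> (comb 0 0 0)" using that by (simp add: \<phi>_comb)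
    then have "comb a b c = comb 0 0 0"
      using bij comb_su2 unfolding bij_betw_def by (meson inj_onD)
    then show ?thesis using comb_zero[of a b c] by (simp add: comb_def[of 0 0 0])
  qed
  have span: "span {X1, X2, X3} = S"
  proof (intro set_eqI iffI)
    fix x assume "x \<in> span {X1, X2, X3}"
    then obtain a b c where "x - a *\<^sub>R X1 - b *\<^sub>R X2 - c *\<^sub>R X3 = 0"
      by (auto simp: span_breakdown_eq)
    then have "x = a *\<^sub>R X1 + b *\<^sub>R X2 + c *\<^sub>R X3" by (simp add: algebra_simps)
    then show "x \<in> S" using S_comb by blast
  next
    fix x assume "x \<in> S"
    then obtain a b c where "x = a *\<^sub>R X1 + b *\<^sub>R X2 + c *\<^sub>R X3" using S_comb by blast
    then show "x \<in> span {X1, X2, X3}" by (auto intro!: span_add span_scale intro: span_base)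
  qed
  have dist: "distinct [X1, X2, X3]"
    using zero[of 1 "-1" 0] zero[of 1 0 "-1"] zero[of 0 1 "-1"] by auto
  have "independent {X1, X2, X3}"
  proof (rule independent_if_scalars_zero)
    fix f x assume "(\<Sum>x\<in>{X1, X2, X3}. f x *\<^sub>R x) = 0" "x \<in> {X1, X2, X3}"
    then show "f x = 0" using dist zero[of "f X1" "f X2" "f X3"] by (auto simp: add.assoc)
  qed simp
  moreover have "br X1 X2 = X3" "br X2 X3 = X1" "br X3 X1 = X2"
    using br[OF A_su2(1,2)] br[OF A_su2(2,3)] br[OF A_su2(3,1)] brackets
    by (simp_all add: X1_def X2_def X3_def)
  ultimately show thesis using that span dist by blast
qed

lemma direct_sum_family_span:
  assumes "direct_sum_family W I V" "subspace W"
  shows "span (\<Union>i\<in>I. V i) = W"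
proof
  have "(\<Union>i\<in>I. V i) \<subseteq> W" using assms(1) by (auto simp: direct_sum_family_def)
  then show "span (\<Union>i\<in>I. V i) \<subseteq> W" using assms(2) by (rule span_minimal)
  show "W \<subseteq> span (\<Union>i\<in>I. V i)"
  proof
    fix x assume "x \<in> W"
    then obtain f where f: "f \<in> (\<Pi>\<^sub>E i\<in>I. V i)" "x = (\<Sum>i\<in>I. f i)"
      using assms(1) unfolding direct_sum_family_def by blast
    then show "x \<in> span (\<Union>i\<in>I. V i)"
      unfolding f(2) by (intro span_sum span_base) (auto simp: PiE_iff)
  qed
qed

lemma direct_sum2_span:
  assumes "direct_sum2 W (span A) (span B)"
  shows "W = span (A \<union> B)"
  using assms by (auto simp: direct_sum2_def span_Un set_plus_def)

theorem theorem1p2: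
  fixes br :: "'a::euclidean_space \<Rightarrow> 'a \<Rightarrow> 'a"
    and Z :: 'a and S K N :: "'a set" and k :: nat and V :: "nat \<Rightarrow> 'a set"
  assumes "lie_algebra br"
    and "isomorphic_su2 br S"
    and "Z \<noteq> 0" and "direct_sum2 K (span {Z}) S"
    and "lie_subalgebra br K"
    and "\<forall>X\<in>S. br Z X = 0"
    and "lie_ideal br N" and "lie_nilpotent br N"
    and "direct_sum2 UNIV K N"
    and "direct_sum_family N {1..k} V"
    and "\<forall>i\<in>{1..k}. irreducible_component br S (V i)"
    and "\<exists>X\<in>S. \<exists>Y\<in>N. br X Y \<noteq> 0"
    and "\<forall>i\<in>{1..k}. \<exists>c>0. \<forall>Y\<in>V i. br Z Y = c *\<^sub>R Y"
  shows "\<exists>ip. inner_product ip \<and> negative_ricci br ip"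
proof -
  have br_bilinear: "bilinear br" using assms(1) by (simp add: lie_algebra_def)
  obtain X1 X2 X3 where X: "br X1 X2 = X3" "br X2 X3 = X1" "br X3 X1 = X2"
    and S: "span {X1, X2, X3} = S" and indep_S: "independent {X1, X2, X3}" "distinct [X1, X2, X3]"
    using su2_standard_basis[OF assms(2)] by blast
  \<comment> \<open>Each \<open>V i\<close> consists of eigenvectors of \<open>ad Z\<close>, so a basis of \<open>N\<close> can be selected from them.\<close>
  define G where "G = {Y \<in> N. \<exists>c>0. br Z Y = c *\<^sub>R Y}"
  have subspace_N: "subspace N" using assms(7) by (simp add: lie_ideal_def)
  have span_G: "span G = N"
  proof
    show "span G \<subseteq> N" by (rule span_minimal[OF _ subspace_N]) (auto simp: G_def)
    have "(\<Union>i\<in>{1..k}. V i) \<subseteq> G"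
      using assms(10,13) by (force simp: G_def direct_sum_family_def)
    then show "N \<subseteq> span G"
      using direct_sum_family_span[OF assms(10) subspace_N] span_mono by blast
  qed
  obtain F where F: "F \<subseteq> G" "independent F" "G \<subseteq> span F"
    using maximal_independent_subset[of G] by blast
  have span_F: "span F = N"
    using span_mono[OF F(1)] span_minimal[OF F(3) subspace_span] span_G by blast
  have K: "K = span ({Z} \<union> {X1, X2, X3})"
    using assms(4) by (intro direct_sum2_span) (simp add: S)
  have KN: "UNIV = span (({Z} \<union> {X1, X2, X3}) \<union> F)"
    using assms(9) by (intro direct_sum2_span) (simp only: K span_F)
  have "span {Z} \<inter> span {X1, X2, X3} = {0}" using assms(4) by (simp only: S direct_sum2_def)
  note indep_K = independent_Un_complementary[OF _ indep_S(1) this]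
  have indep_Z: "independent {Z}" using assms(3) by simp
  have "span ({Z} \<union> {X1, X2, X3}) \<inter> span F = {0}"
    using assms(9) by (simp only: direct_sum2_def K span_F)
  note indep = independent_Un_complementary[OF indep_K(1)[OF indep_Z] F(2) this]
  obtain ip where ip: "orthonormal_frame ip (({Z} \<union> {X1, X2, X3}) \<union> F)"
    using ex_orthonormal_frame[OF indep(1) KN[symmetric]] by blast
  obtain X Y where XY: "X \<in> S" "Y \<in> N" "br X Y \<noteq> 0" using assms(12) by blast
  have X_in_S: "X1 \<in> S" "X2 \<in> S" "X3 \<in> S" unfolding S[symmetric] by (simp_all add: span_base)
  interpret orthonormal_frame ip "({Z} \<union> {X1, X2, X3}) \<union> F" by (rule ip)
  interpret su2_frame ip "({Z} \<union> {X1, X2, X3}) \<union> F" br Z X1 X2 X3 F 1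
  proof unfold_locales
    show "F \<noteq> {}"
    proof
      assume "F = {}"
      then have "Y = 0" using XY(2) span_F by auto
      then show False using XY(3) bilinear_rzero[OF br_bilinear] by simp
    qed
    show "br x v \<in> span F" if "v \<in> F" for x v
      using that assms(7) span_F F(1) by (auto simp: lie_ideal_def G_def)
    show "\<exists>c>0. br Z u = c *\<^sub>R u" if "u \<in> F" for u
      using that F(1) by (auto simp: G_def)
  qed (use assms(1,6) X X_in_S indep(2) indep_K(2)[OF indep_Z] indep_S(2) in auto)
  have "\<exists>a\<in>R. \<exists>v\<in>F. br a v \<noteq> 0"
  proof (rule ccontr)
    assume "\<not> ?thesis"
    then have "br a Y = 0" if "a \<in> R" for a
      using that annihilates_span[of a Y] XY(2) span_F by blast
    then have "br X Y = 0"
      using linear_eq_0_on_span[OF linear_br_left, of R Y X] XY(1) S by (simp add: R_def)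
    then show False using XY(3) by simp
  qed
  then show ?thesis using ex_negative_ricci by simp
qed

end
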